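(* Let $A\in\Sigma$ ($S$ arbitrary). Then (a) $\mathcal H_A^\perp\subset\overline{F_A}$; (b) for $\phi\in\mathcal H$: if $\phi_\pi=0$ or $\mathbb P_{\phi_\pi}(A)=0$, then $\phi\in\overline{F_A}$. If moreover $\Gamma(t)$ is finite for every $t\in S$, then (c) $\mathcal H_A=F_A^\perp$ and $\mathcal H_A^\perp=\overline{F_A}$; (d) $\phi\in\overline{F_A}$ if and only if $\phi_\pi=0$ or $\mathbb P_{\phi_\pi}(A)=0$; (e) $\mathcal H_A=\overline{F_{A^c}}\cap\mathcal H_\pi=\overline{F_{A^c}\cap\mathcal H_\pi}$.
   Context: Let $\mathcal H$ be a complex Hilbert space. A projection is a bounded self-adjoint idempotent operator; $\wedge_\alpha p_\alpha$ denotes the projection onto the intersection of the ranges of the projections $p_\alpha$. For $\phi\neq0$, $\hat\phi=\phi/\|\phi\|$; $\overline V$ is the closure of $V$. Sums of countably many operators are understood strongly. Let $S$ be an arbitrary set; for each $t\in S$ let $\Gamma(t)$ be a countable set and for $a\in\Gamma(t)$ let $p^t_a$ be a projection on $\mathcal H$ with $\sum_{a\in\Gamma(t)}p^t_a=I$. Let $\pi=\{p^t_a\}$ and $p^{t_1,\dots,t_k}_{a_1,\dots,a_k}=\wedge_{i=1}^kp^{t_i}_{a_i}$. $\pi$ commutes on $\phi$ if $W\phi=V\phi$ whenever $W,V$ are finite products of elements of $\pi$ with the same factors (with multiplicity) in possibly different orders; $\mathcal H_\pi$ is the closed subspace of such $\phi$, $p_\pi$ its projection, $\phi_\pi=p_\pi\phi$.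 Let $\Omega=\prod_{t\in S}\Gamma(t)$, $X_t(\omega)=\omega_t$, $\Sigma$ the σ-algebra generated by the sets $\{X_t=a\}$. For $\phi\in\mathcal H_\pi\setminus\{0\}$, $\mathbb P_\phi$ is the unique probability measure on $(\Omega,\Sigma)$ with $\mathbb P_\phi(X_{t_i}=a_i,\ i=1,\dots,k)=\|p^{t_1,\dots,t_k}_{a_1,\dots,a_k}\hat\phi\|^2$ for all choices of $t_i, a_i$ (it exists and is unique). For $A\in\Sigma$, $\mathcal H_A=\{\phi\in\mathcal H_\pi:\phi=0\text{ or }\mathbb P_\phi(A)=1\}$ (a closed subspace). For $A\subset\Omega$, $F_A=\{\phi\in\mathcal H:$ for every $\omega\in A$ there are $t_1,\dots,t_k\in S$ with $p^{t_1,\dots,t_k}_{\omega_{t_1},\dots,\omega_{t_k}}\phi=0\}$. *)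

theory Defs
  imports "HOL-Analysis.Analysis" "HOL-Probability.Probability" "HOL-Library.Multiset"
begin

class complex_vector = real_vector +
  fixes scaleC :: "complex \<Rightarrow> 'a \<Rightarrow> 'a"
  assumes scaleC_add_right: "scaleC c (x + y) = scaleC c x + scaleC c y"
    and scaleC_add_left: "scaleC (c + d) x = scaleC c x + scaleC d x"
    and scaleC_scaleC: "scaleC c (scaleC d x) = scaleC (c * d) x"
    and scaleC_one: "scaleC 1 x = x"
    and scaleR_scaleC: "scaleR r x = scaleC (complex_of_real r) x"

class complex_normed_vector = complex_vector + real_normed_vector +
  assumes norm_scaleC: "norm (scaleC c x) = cmod c * norm x"

class complex_inner = complex_normed_vector +
  fixes cinner :: "'a \<Rightarrow> 'a \<Rightarrow> complex"
  assumes cinner_commute: "cinner x y = cnj (cinner y x)"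
    and cinner_add_left: "cinner (x + y) z = cinner x z + cinner y z"
    and cinner_scaleC_left: "cinner (scaleC c x) y = cnj c * cinner x y"
    and cinner_self_norm: "cinner x x = complex_of_real ((norm x)\<^sup>2)"

class chilbert_space = complex_inner + complete_space

definition bounded_clinear :: "('a::complex_normed_vector \<Rightarrow> 'b::complex_normed_vector) \<Rightarrow> bool" where
  "bounded_clinear f \<longleftrightarrow>
     (\<forall>x y. f (x + y) = f x + f y) \<and> (\<forall>c x. f (scaleC c x) = scaleC c (f x)) \<and>
     (\<exists>K. \<forall>x. norm (f x) \<le> norm x * K)"

definition is_projection :: "('a::complex_inner \<Rightarrow> 'a) \<Rightarrow> bool" where
  "is_projection P \<longleftrightarrow> bounded_clinear P \<and> P \<circ> P = P \<and>
     (\<forall>x y. cinner (P x) y = cinner x (P y))"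

definition orth :: "'a::complex_inner set \<Rightarrow> 'a set" where
  "orth V = {x. \<forall>y\<in>V. cinner x y = 0}"

definition proj_onto :: "'a::complex_inner set \<Rightarrow> 'a \<Rightarrow> 'a" where
  "proj_onto V x = (THE y. y \<in> V \<and> (\<forall>v\<in>V. cinner (x - y) v = 0))"

text \<open>\<open>p^{t_1..t_k}_{a_1..a_k}\<close>: the projection onto the intersection of the ranges of
  the \<open>p t (a t)\<close>, \<open>t \<in> T\<close> (for \<open>T = {}\<close> this is the identity).\<close>
definition wedge :: "('s \<Rightarrow> 'b \<Rightarrow> 'h::complex_inner \<Rightarrow> 'h) \<Rightarrow> 's set \<Rightarrow> ('s \<Rightarrow> 'b) \<Rightarrow> 'h \<Rightarrow> 'h" where
  "wedge p T a = proj_onto (\<Inter>t\<in>T. range (p t (a t)))"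

definition pi_set :: "'s set \<Rightarrow> ('s \<Rightarrow> 'b set) \<Rightarrow> ('s \<Rightarrow> 'b \<Rightarrow> 'h \<Rightarrow> 'h) \<Rightarrow> ('h \<Rightarrow> 'h) set" where
  "pi_set S \<Gamma> p = {p t a | t a. t \<in> S \<and> a \<in> \<Gamma> t}"

definition PVM_family :: "'s set \<Rightarrow> ('s \<Rightarrow> 'b set) \<Rightarrow> ('s \<Rightarrow> 'b \<Rightarrow> 'h::chilbert_space \<Rightarrow> 'h) \<Rightarrow> bool" where
  "PVM_family S \<Gamma> p \<longleftrightarrow> (\<forall>t\<in>S. countable (\<Gamma> t) \<and> (\<forall>a\<in>\<Gamma> t. is_projection (p t a)) \<and>
        (\<forall>x. ((\<lambda>a. p t a x) has_sum x) (\<Gamma> t)))"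

definition op_prod :: "('h \<Rightarrow> 'h) list \<Rightarrow> 'h \<Rightarrow> 'h" where
  "op_prod Ws = foldr (\<circ>) Ws id"

definition commutes_on :: "('h \<Rightarrow> 'h) set \<Rightarrow> 'h \<Rightarrow> bool" where
  "commutes_on \<pi> \<phi> \<longleftrightarrow> (\<forall>Ws Vs. set Ws \<subseteq> \<pi> \<longrightarrow> set Vs \<subseteq> \<pi> \<longrightarrow> mset Ws = mset Vs \<longrightarrow>
        op_prod Ws \<phi> = op_prod Vs \<phi>)"

definition H_pi :: "('h \<Rightarrow> 'h) set \<Rightarrow> 'h set" where
  "H_pi \<pi> = {\<phi>. commutes_on \<pi> \<phi>}"

definition Omega :: "'s set \<Rightarrow> ('s \<Rightarrow> 'b set) \<Rightarrow> ('s \<Rightarrow> 'b) set" where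
  "Omega S \<Gamma> = PiE S \<Gamma>"

definition Sigma_alg :: "'s set \<Rightarrow> ('s \<Rightarrow> 'b set) \<Rightarrow> ('s \<Rightarrow> 'b) set set" where
  "Sigma_alg S \<Gamma> = sigma_sets (Omega S \<Gamma>) {{\<omega> \<in> Omega S \<Gamma>. \<omega> t = a} | t a. t \<in> S \<and> a \<in> \<Gamma> t}"

definition is_P_family :: "'s set \<Rightarrow> ('s \<Rightarrow> 'b set) \<Rightarrow> ('s \<Rightarrow> 'b \<Rightarrow> 'h::chilbert_space \<Rightarrow> 'h)
    \<Rightarrow> ('h \<Rightarrow> ('s \<Rightarrow> 'b) measure) \<Rightarrow> bool" where
  "is_P_family S \<Gamma> p P \<longleftrightarrow>
    (\<forall>\<phi> \<in> H_pi (pi_set S \<Gamma> p) - {0}.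
       prob_space (P \<phi>) \<and> space (P \<phi>) = Omega S \<Gamma> \<and> sets (P \<phi>) = Sigma_alg S \<Gamma> \<and>
       (\<forall>T a. finite T \<longrightarrow> T \<subseteq> S \<longrightarrow> a \<in> Pi T \<Gamma> \<longrightarrow>
          measure (P \<phi>) {\<omega> \<in> Omega S \<Gamma>. \<forall>t\<in>T. \<omega> t = a t} = (norm (wedge p T a (sgn \<phi>)))\<^sup>2))"

definition H_event :: "'s set \<Rightarrow> ('s \<Rightarrow> 'b set) \<Rightarrow> ('s \<Rightarrow> 'b \<Rightarrow> 'h::chilbert_space \<Rightarrow> 'h)
    \<Rightarrow> ('h \<Rightarrow> ('s \<Rightarrow> 'b) measure) \<Rightarrow> ('s \<Rightarrow> 'b) set \<Rightarrow> 'h set" where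
  "H_event S \<Gamma> p P A = {\<phi> \<in> H_pi (pi_set S \<Gamma> p). \<phi> = 0 \<or> measure (P \<phi>) A = 1}"

definition F_set :: "'s set \<Rightarrow> ('s \<Rightarrow> 'b \<Rightarrow> 'h::chilbert_space \<Rightarrow> 'h) \<Rightarrow> ('s \<Rightarrow> 'b) set \<Rightarrow> 'h set" where
  "F_set S p A = {\<phi>. \<forall>\<omega>\<in>A. \<exists>T. finite T \<and> T \<subseteq> S \<and> wedge p T \<omega> \<phi> = 0}"

end

theory Submission
  imports Defs
begin

text \<open>
  For a finite product \<open>Q\<close> of the projections, attached to a cylinder \<open>C\<close>, and \<open>\<phi> \<in> H\<^sub>\<pi>\<close>, the
  vector \<open>\<phi> - Q \<phi>\<close> carries the restriction of \<open>\<parallel>\<phi>\<parallel>\<^sup>2 P\<^sub>\<phi>\<close> to the complement of \<open>C\<close>.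
  By outer regularity, \<open>A\<close> is covered by countably many cylinders of total mass close to that of
  \<open>A\<close>; removing them from \<open>\<phi>\<close> one after the other converges to a vector of \<open>F\<^sub>A\<close> whose squared
  distance to \<open>\<phi>\<close> is at most \<open>\<parallel>\<phi>\<parallel>\<^sup>2 P\<^sub>\<phi>(A)\<close> up to \<open>\<epsilon>\<close>. Moreover \<open>F\<^sub>A\<close> contains all
  \<open>(W - V) \<chi>\<close> with \<open>W\<close>, \<open>V\<close> products of the same factors, so a vector orthogonal to \<open>F\<^sub>A\<close> lies
  in \<open>H\<^sub>\<pi>\<close>. These two facts give (a) and (b). If all \<open>\<Gamma>(t)\<close> are finite, \<open>\<Omega>\<close> is compact, and
  finitely many of the cylinders annihilating \<open>y \<in> F\<^sub>A\<close> cover \<open>A\<close> up to a set of small measure;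
  removing those from \<open>x \<in> H\<^sub>\<pi>\<close> does not change its inner product with \<open>y\<close>, which yields
  \<open>|\<langle>y, x\<rangle>|\<^sup>2 \<le> \<parallel>y\<parallel>\<^sup>2 \<parallel>x\<parallel>\<^sup>2 P\<^sub>x(A\<^sup>c)\<close> and hence (c)-(e).
\<close>

section \<open>Complex Hilbert spaces\<close>


lemma scaleC_minus_one: "scaleC (-1) x = - (x::'a::complex_vector)"
  using scaleR_scaleC[of "-1" x] by simp

lemma cinner_add_right: "cinner x (y + z) = cinner x y + cinner x (z::'a::complex_inner)"
  by (metis cinner_commute cinner_add_left complex_cnj_add)

lemma cinner_scaleC_right: "cinner x (scaleC c y) = c * cinner x (y::'a::complex_inner)"
  by (metis cinner_commute cinner_scaleC_left complex_cnj_cnj complex_cnj_mult)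

lemma cinner_scaleR_right: "cinner x (scaleR r y) = of_real r * cinner x (y::'a::complex_inner)"
  by (simp add: scaleR_scaleC cinner_scaleC_right)

lemma cinner_minus_right: "cinner x (- y) = - cinner x (y::'a::complex_inner)"
  using cinner_scaleC_right[of x "-1" y] by (simp add: scaleC_minus_one)

lemma cinner_minus_left: "cinner (- x) y = - cinner x (y::'a::complex_inner)"
  using cinner_scaleC_left[of "-1" x y] by (simp add: scaleC_minus_one)

lemma cinner_diff_right: "cinner x (y - z) = cinner x y - cinner x (z::'a::complex_inner)"
  using cinner_add_right[of x y "-z"] by (simp add: cinner_minus_right)

lemma cinner_diff_left: "cinner (x - y) z = cinner x z - cinner y (z::'a::complex_inner)"
  using cinner_add_left[of x "-y" z] by (simp add: cinner_minus_left)

lemma cinner_zero_left [simp]: "cinner 0 (x::'a::complex_inner) = 0"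
  using cinner_diff_left[of x x x] by simp

lemma cinner_zero_right [simp]: "cinner (x::'a::complex_inner) 0 = 0"
  using cinner_diff_right[of x x x] by simp

lemma cinner_self_eq_0 [simp]: "cinner x x = 0 \<longleftrightarrow> x = (0::'a::complex_inner)"
  by (simp add: cinner_self_norm)

lemma cinner_eq_0_commute: "cinner x y = 0 \<longleftrightarrow> cinner y (x::'a::complex_inner) = 0"
  by (metis cinner_commute complex_cnj_zero)

lemma norm_add_square:
  "(norm (x + y))\<^sup>2 = (norm x)\<^sup>2 + (norm y)\<^sup>2 + 2 * Re (cinner x (y::'a::complex_inner))"
proof -
  have "complex_of_real ((norm (x + y))\<^sup>2) = cinner x x + cinner y y + (cinner x y + cnj (cinner x y))"
    unfolding cinner_self_norm[symmetric] cinner_commute[of y x, symmetric]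
    by (simp add: cinner_add_left cinner_add_right)
  then have "Re (complex_of_real ((norm (x + y))\<^sup>2)) = Re \<dots>" by simp
  then show ?thesis by (simp add: cinner_self_norm)
qed

lemma norm_diff_square:
  "(norm (x - y))\<^sup>2 = (norm x)\<^sup>2 + (norm y)\<^sup>2 - 2 * Re (cinner x (y::'a::complex_inner))"
  using norm_add_square[of x "-y"] by (simp add: cinner_minus_right)

text \<open>Pythagoras for the component of \<open>x\<close> along \<open>y\<close>. Cauchy-Schwarz
  and the orthogonality at nearest points both come from this identity.\<close>

lemma norm_diff_component:
  fixes x y :: "'a::complex_inner"
  assumes "y \<noteq> 0"
  obtains c where "(norm (x - scaleC c y))\<^sup>2 = (norm x)\<^sup>2 - (cmod (cinner x y) / norm y)\<^sup>2"
proof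
  \<comment> \<open>\<open>cinner\<close> is conjugate linear in its first argument, so the
    coefficient of the projection of \<open>x\<close> onto the line through \<open>y\<close> has
    \<open>y\<close> on the left.\<close>
  define c where "c = cinner y x / of_real ((norm y)\<^sup>2)"
  have "cinner x y * cinner y x = of_real ((cmod (cinner x y))\<^sup>2)"
    using complex_norm_square[of "cinner x y"] cinner_commute[of y x] by simp
  then have eq: "cinner x (scaleC c y) = of_real ((cmod (cinner x y) / norm y)\<^sup>2)"
    by (simp add: cinner_scaleC_right c_def power_divide mult.commute)
  have "cmod (cinner y x) = cmod (cinner x y)" using cinner_commute[of y x] by simp
  then have "norm (scaleC c y) = cmod (cinner x y) / norm y"
    using assms by (simp add: norm_scaleC c_def norm_divide norm_mult power2_eq_square)
  with eq show "(norm (x - scaleC c y))\<^sup>2 = (norm x)\<^sup>2 - (cmod (cinner x y) / norm y)\<^sup>2"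
    unfolding norm_diff_square by simp
qed

lemma cmod_cinner_le: "cmod (cinner x y) \<le> norm x * norm (y::'a::complex_inner)"
proof (cases "y = 0")
  case False
  obtain c where c: "(norm (x - scaleC c y))\<^sup>2 = (norm x)\<^sup>2 - (cmod (cinner x y) / norm y)\<^sup>2"
    using norm_diff_component[OF False] .
  have "0 \<le> (norm (x - scaleC c y))\<^sup>2" by simp
  then have "(cmod (cinner x y) / norm y)\<^sup>2 \<le> (norm x)\<^sup>2" unfolding c by simp
  then have "cmod (cinner x y) / norm y \<le> norm x" by (rule power2_le_imp_le) simp
  with False show ?thesis by (simp add: field_simps)
qed simp

lemma bounded_linear_cinner_right: "bounded_linear (cinner (x::'a::complex_inner))"
  by (rule bounded_linear_intro[where K = "norm x"])
    (auto simp: cinner_add_right cinner_scaleR_right scaleR_conv_of_real mult.commute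
      intro: order_trans[OF cmod_cinner_le])

lemma bounded_linear_cinner_left: "bounded_linear (\<lambda>x. cinner x (y::'a::complex_inner))"
proof -
  have "(\<lambda>x. cinner x y) = (\<lambda>x. cnj (cinner y x))" using cinner_commute by blast
  then show ?thesis
    by (simp add: bounded_linear_compose[OF bounded_linear_cnj bounded_linear_cinner_right])
qed

lemma continuous_on_cinner_left: "continuous_on UNIV (\<lambda>x. cinner x (y::'a::complex_inner))"
  by (rule bounded_linear.continuous_on[OF bounded_linear_cinner_left continuous_on_id])

section \<open>Closed subspaces and orthogonal projections\<close>

definition csubspace :: "'a::complex_vector set \<Rightarrow> bool" where
  "csubspace V \<longleftrightarrow> 0 \<in> V \<and> (\<forall>x\<in>V. \<forall>y\<in>V. x + y \<in> V) \<and> (\<forall>c. \<forall>x\<in>V. scaleC c x \<in> V)"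

lemma csubspace_diff: "csubspace V \<Longrightarrow> x \<in> V \<Longrightarrow> y \<in> V \<Longrightarrow> x - y \<in> V"
  unfolding csubspace_def by (metis add_uminus_conv_diff scaleC_minus_one)

lemma csubspace_scaleR: "csubspace V \<Longrightarrow> x \<in> V \<Longrightarrow> r *\<^sub>R x \<in> V"
  unfolding csubspace_def by (simp add: scaleR_scaleC)

lemma bounded_linear_scaleC: "bounded_linear (scaleC c :: 'a::complex_normed_vector \<Rightarrow> 'a)"
  by (rule bounded_linear_intro[where K = "cmod c"])
    (auto simp: scaleC_add_right scaleR_scaleC scaleC_scaleC mult.commute norm_scaleC)

lemma csubspace_closure:
  fixes V :: "'a::complex_normed_vector set"
  assumes "csubspace V"
  shows "csubspace (closure V)"
  unfolding csubspace_def
proof (intro conjI ballI allI)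
  show "0 \<in> closure V" using assms closure_subset unfolding csubspace_def by blast
next
  fix x y assume "x \<in> closure V" "y \<in> closure V"
  then obtain f g where f: "\<And>n::nat. f n \<in> V" "f \<longlonglongrightarrow> x" and g: "\<And>n::nat. g n \<in> V" "g \<longlonglongrightarrow> y"
    unfolding closure_sequential by blast
  have "(\<lambda>n. f n + g n) \<longlonglongrightarrow> x + y" using f g by (intro tendsto_add)
  moreover have "f n + g n \<in> V" for n using f g assms unfolding csubspace_def by blast
  ultimately show "x + y \<in> closure V"
    unfolding closure_sequential by (intro exI[of _ "\<lambda>n. f n + g n"]) auto
next
  fix c x assume "x \<in> closure V"
  then obtain f where f: "\<And>n::nat. f n \<in> V" "f \<longlonglongrightarrow> x"
    unfolding closure_sequential by blast
  have "(\<lambda>n. scaleC c (f n)) \<longlonglongrightarrow> scaleC c x"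
    by (rule bounded_linear.tendsto[OF bounded_linear_scaleC f(2)])
  moreover have "scaleC c (f n) \<in> V" for n using f assms unfolding csubspace_def by blast
  ultimately show "scaleC c x \<in> closure V"
    unfolding closure_sequential by (intro exI[of _ "\<lambda>n. scaleC c (f n)"]) auto
qed

lemma parallelogram_law:
  "(norm (x + y))\<^sup>2 + (norm (x - y))\<^sup>2 = 2 * (norm x)\<^sup>2 + 2 * (norm (y::'a::complex_inner))\<^sup>2"
  by (simp add: norm_add_square norm_diff_square)

lemma minimal_distance_orthogonal:
  fixes z v :: "'a::complex_inner"
  assumes "\<And>c. norm z \<le> norm (z - scaleC c v)"
  shows "cinner z v = 0"
proof (cases "v = 0")
  case False
  obtain c where c: "(norm (z - scaleC c v))\<^sup>2 = (norm z)\<^sup>2 - (cmod (cinner z v) / norm v)\<^sup>2"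
    using norm_diff_component[OF False] .
  have "(norm z)\<^sup>2 \<le> (norm (z - scaleC c v))\<^sup>2" using assms by (simp add: power_mono)
  with c False show ?thesis by simp
qed simp

text \<open>A sequence in \<open>V\<close> whose distances to \<open>x\<close> tend to the infimum
  is Cauchy by the parallelogram law. Its limit is a nearest point, and a nearest point leaves an
  orthogonal remainder.\<close>

lemma orthogonal_projection_exists:
  fixes V :: "'a::chilbert_space set"
  assumes V: "csubspace V" and cl: "closed V"
  obtains y where "y \<in> V" "\<And>v. v \<in> V \<Longrightarrow> cinner (x - y) v = 0"
proof -
  define d where "d = infdist x V"
  have ne: "V \<noteq> {}" using V by (auto simp: csubspace_def)
  have d: "d \<le> norm (x - v)" if "v \<in> V" for v
    using infdist_le[OF that, of x] by (simp add: d_def dist_norm)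
  have d0: "0 \<le> d" by (simp add: d_def infdist_nonneg)
  have "\<exists>v\<in>V. norm (x - v) < d + inverse (Suc n)" for n
  proof -
    have "d < d + inverse (Suc n)" by simp
    then show ?thesis using ne cInf_lessD[of "(dist x) ` V" "d + inverse (Suc n)"]
      by (auto simp: d_def infdist_def dist_norm)
  qed
  then obtain f where f: "\<And>n. f n \<in> V" "\<And>n. norm (x - f n) < d + inverse (Suc n)" by metis
  have lim: "(\<lambda>n. norm (x - f n)) \<longlonglongrightarrow> d"
  proof (rule real_tendsto_sandwich)
    show "\<forall>\<^sub>F n in sequentially. d \<le> norm (x - f n)" using d f(1) by simp
    show "\<forall>\<^sub>F n in sequentially. norm (x - f n) \<le> d + inverse (Suc n)"
      using f(2) by (intro always_eventually allI less_imp_le)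
    show "(\<lambda>n. d + inverse (real (Suc n))) \<longlonglongrightarrow> d"
      using tendsto_add[OF tendsto_const LIMSEQ_inverse_real_of_nat] by simp
  qed simp
  \<comment> \<open>The midpoint of \<open>f m\<close> and \<open>f n\<close> lies in
    \<open>V\<close>, hence at distance at least \<open>d\<close> from \<open>x\<close>.\<close>
  have par: "(norm (f m - f n))\<^sup>2 \<le> 2 * ((norm (x - f m))\<^sup>2 - d\<^sup>2) + 2 * ((norm (x - f n))\<^sup>2 - d\<^sup>2)" for m n
  proof -
    have "(1/2) *\<^sub>R (f m + f n) \<in> V" using f(1) V by (meson csubspace_def csubspace_scaleR)
    from d[OF this] have "2 * d \<le> norm (2 *\<^sub>R (x - (1/2) *\<^sub>R (f m + f n)))" by simp
    also have "2 *\<^sub>R (x - (1/2) *\<^sub>R (f m + f n)) = (x - f m) + (x - f n)"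
      by (simp add: algebra_simps scaleR_2)
    finally have "(2 * d)\<^sup>2 \<le> (norm ((x - f m) + (x - f n)))\<^sup>2" using d0 by (intro power_mono) auto
    moreover have "norm ((x - f m) - (x - f n)) = norm (f m - f n)" 
      using norm_minus_commute[of "f m" "f n"] by simp
    ultimately show ?thesis using parallelogram_law[of "x - f m" "x - f n"]
      by (simp add: power_mult_distrib)
  qed
  have "Cauchy f"
  proof (rule metric_CauchyI)
    fix e :: real assume e: "0 < e"
    have "(\<lambda>n. (norm (x - f n))\<^sup>2) \<longlonglongrightarrow> d\<^sup>2" by (intro tendsto_power lim)
    then obtain N where N: "\<And>n. n \<ge> N \<Longrightarrow> \<bar>(norm (x - f n))\<^sup>2 - d\<^sup>2\<bar> < e\<^sup>2 / 4"
      using LIMSEQ_D[of _ _ "e\<^sup>2 / 4"] e by (metis real_norm_def zero_less_divide_iff zero_less_numeral zero_less_power)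
    have "dist (f m) (f n) < e" if "m \<ge> N" "n \<ge> N" for m n
    proof -
      have "(norm (f m - f n))\<^sup>2 < e\<^sup>2"
        using par[of m n] N[OF that(1)] N[OF that(2)] unfolding abs_less_iff by argo
      then show ?thesis using e by (simp add: dist_norm power2_less_imp_less)
    qed
    then show "\<exists>N. \<forall>m\<ge>N. \<forall>n\<ge>N. dist (f m) (f n) < e" by blast
  qed
  then obtain y where y: "f \<longlonglongrightarrow> y" using Cauchy_convergent convergent_def by blast
  have yV: "y \<in> V" using cl f(1) y by (rule closed_sequentially)
  have "(\<lambda>n. norm (x - f n)) \<longlonglongrightarrow> norm (x - y)" by (intro tendsto_intros y)
  with lim have nd: "norm (x - y) = d" by (rule LIMSEQ_unique[rotated])
  show ?thesis
  proof (rule that[OF yV])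
    fix v assume v: "v \<in> V"
    show "cinner (x - y) v = 0"
    proof (rule minimal_distance_orthogonal)
      fix c
      have "y + scaleC c v \<in> V" using V v yV by (auto simp: csubspace_def)
      from d[OF this] show "norm (x - y) \<le> norm (x - y - scaleC c v)"
        by (simp add: nd diff_diff_eq)
    qed
  qed
qed

text \<open>Makes the definite description in \<open>proj_onto\<close> usable: two candidates differ
  by a vector of \<open>V\<close> that is orthogonal to itself.\<close>

lemma proj_onto_eqI:
  fixes V :: "'a::complex_inner set"
  assumes "csubspace V" "y \<in> V" "\<And>v. v \<in> V \<Longrightarrow> cinner (x - y) v = 0"
  shows "proj_onto V x = y"
  unfolding proj_onto_def
proof (rule the_equality)
  fix z assume z: "z \<in> V \<and> (\<forall>v\<in>V. cinner (x - z) v = 0)"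
  then have zy: "z - y \<in> V" using assms csubspace_diff by blast
  have "cinner (z - y) (z - y) = cinner (x - y) (z - y) - cinner (x - z) (z - y)"
    by (simp add: cinner_diff_left)
  also have "\<dots> = 0" using zy z assms(3) by simp
  finally show "z = y" by simp
qed (use assms in auto)

lemma proj_onto_props:
  fixes V :: "'a::chilbert_space set"
  assumes "csubspace V" "closed V"
  shows "proj_onto V x \<in> V" "v \<in> V \<Longrightarrow> cinner (x - proj_onto V x) v = 0"
  using orthogonal_projection_exists[OF assms, of x] proj_onto_eqI[OF assms(1)] by metis+

lemma proj_onto_eq_0_iff:
  fixes V :: "'a::chilbert_space set"
  assumes "csubspace V" "closed V"
  shows "proj_onto V x = 0 \<longleftrightarrow> x \<in> orth V"
  using proj_onto_props(2)[OF assms, of _ x] proj_onto_eqI[OF assms(1), of 0 x] assms(1)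
  by (fastforce simp: orth_def csubspace_def)

lemma closed_orth: "closed (orth (V::'a::complex_inner set))"
proof -
  have "orth V = (\<Inter>y\<in>V. {x. cinner x y = 0})" by (auto simp: orth_def)
  moreover have "closed {x. cinner x y = 0}" for y :: 'a
    by (intro closed_Collect_eq continuous_on_cinner_left continuous_on_const)
  ultimately show ?thesis by auto
qed

lemma orth_antimono: "V \<subseteq> W \<Longrightarrow> orth W \<subseteq> orth V"
  by (auto simp: orth_def)

text \<open>For the harder inclusion, \<open>x\<close> is projected to \<open>y\<close> in the
  closure of \<open>V\<close>. The remainder \<open>x - y\<close> is orthogonal to \<open>V\<close>,
  hence to both \<open>x\<close> and \<open>y\<close>, hence to itself.\<close>

lemma orth_orth:
  fixes V :: "'a::chilbert_space set"
  assumes V: "csubspace V"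
  shows "orth (orth V) = closure V"
proof
  have "V \<subseteq> orth (orth V)" by (auto simp: orth_def cinner_eq_0_commute)
  then show "closure V \<subseteq> orth (orth V)" by (intro closure_minimal closed_orth)
next
  show "orth (orth V) \<subseteq> closure V"
  proof
    fix x assume x: "x \<in> orth (orth V)"
    obtain y where y: "y \<in> closure V" "\<And>v. v \<in> closure V \<Longrightarrow> cinner (x - y) v = 0"
      using orthogonal_projection_exists[OF csubspace_closure[OF V] closed_closure] by metis
    have "x - y \<in> orth V" using y(2) closure_subset by (fastforce simp: orth_def)
    then have "cinner x (x - y) = 0" using x by (simp add: orth_def)
    moreover have "cinner y (x - y) = 0" using y cinner_eq_0_commute by blast
    ultimately have "cinner (x - y) (x - y) = 0" by (simp add: cinner_diff_left)
    with y(1) show "x \<in> closure V" by simp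
  qed
qed


section \<open>Families of projection-valued measures\<close>

lemma bounded_clinear_imp_bounded_linear: "bounded_clinear f \<Longrightarrow> bounded_linear f"
  unfolding bounded_clinear_def
  by (metis bounded_linear_intro scaleR_scaleC)

lemma is_projectionD:
  assumes "is_projection P"
  shows "P (P x) = P x" "cinner (P x) y = cinner x (P y)" "P (x + y) = P x + P y"
    "P (scaleC c x) = scaleC c (P x)" "bounded_linear P"
  using assms bounded_clinear_imp_bounded_linear
  by (auto simp: is_projection_def bounded_clinear_def fun_eq_iff)

lemma norm_is_projection:
  assumes "is_projection P"
  shows "(norm (P x))\<^sup>2 = Re (cinner x (P x))"
proof -
  have "cinner (P x) (P x) = cinner x (P x)" by (simp add: is_projectionD[OF assms])
  then have "Re (complex_of_real ((norm (P x))\<^sup>2)) = Re (cinner x (P x))"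
    unfolding cinner_self_norm by simp
  then show ?thesis by simp
qed

lemma range_is_projection: "is_projection P \<Longrightarrow> range P = {v. P v = v}"
  by (auto simp: is_projectionD(1)) (metis rangeI)

section \<open>Finite products of operators\<close>

lemma op_prod_simps [simp]:
  "op_prod [] = id" "op_prod (W # Ws) = W \<circ> op_prod Ws"
  by (simp_all add: op_prod_def)

lemma op_prod_append [simp]: "op_prod (Ws @ Vs) = op_prod Ws \<circ> op_prod Vs"
  by (induction Ws) (auto simp: comp_assoc)

lemma bounded_clinear_op_prod:
  assumes "\<And>W. W \<in> set Ws \<Longrightarrow> bounded_clinear W"
  shows "bounded_linear (op_prod Ws)" "op_prod Ws (scaleC c x) = scaleC c (op_prod Ws x)"
  using assms
proof (induction Ws)
  case (Cons W Ws)
  { case 1 with Cons show ?case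
      by (simp add: o_def bounded_linear_compose bounded_clinear_imp_bounded_linear) }
  { case 2 with Cons show ?case by (simp add: bounded_clinear_def) }
qed (simp_all add: id_def bounded_linear_ident)

lemma cinner_op_prod_left:
  assumes "\<And>W. W \<in> set Ws \<Longrightarrow> is_projection W"
  shows "cinner (op_prod Ws x) y = cinner x (op_prod (rev Ws) y)"
  using assms by (induction Ws arbitrary: x y) (simp_all add: is_projectionD(2))

text \<open>On such a \<open>v\<close> only the set of factors matters, neither their order nor
  their multiplicity.\<close>

lemma op_prod_eigenvector:
  assumes "\<And>W. W \<in> set Ws \<Longrightarrow> W v = v \<or> W v = 0" "\<And>W. W \<in> set Ws \<Longrightarrow> W 0 = 0"
  shows "op_prod Ws v = (if \<forall>W\<in>set Ws. W v = v then v else 0)"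
  using assms by (induction Ws) fastforce+

locale pvm_family =
  fixes S :: "'s set" and \<Gamma> :: "'s \<Rightarrow> 'b set"
    and p :: "'s \<Rightarrow> 'b \<Rightarrow> 'h::chilbert_space \<Rightarrow> 'h"
  assumes pvm: "PVM_family S \<Gamma> p"
begin

lemma projection: "t \<in> S \<Longrightarrow> a \<in> \<Gamma> t \<Longrightarrow> is_projection (p t a)"
  using pvm by (simp add: PVM_family_def)

lemma countable_outcomes: "t \<in> S \<Longrightarrow> countable (\<Gamma> t)"
  using pvm by (simp add: PVM_family_def)

text \<open>Expand \<open>y = p t a x\<close> in the resolution of the identity at \<open>t\<close>.
  The squared norms of the parts add up to that of \<open>y\<close>, and the part for
  \<open>a\<close> is already \<open>y\<close> itself, so nothing is left for
  \<open>b\<close>.\<close>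

lemma projections_orthogonal:
  assumes t: "t \<in> S" and a: "a \<in> \<Gamma> t" and b: "b \<in> \<Gamma> t" and ab: "a \<noteq> b"
  shows "p t b (p t a x) = 0"
proof -
  define y where "y = p t a x"
  have y: "p t a y = y" by (simp add: y_def is_projectionD(1)[OF projection[OF t a]])
  have "((\<lambda>c. p t c y) has_sum y) (\<Gamma> t)" using pvm t by (simp add: PVM_family_def)
  then have "((\<lambda>c. Re (cinner y (p t c y))) has_sum Re (cinner y y)) (\<Gamma> t)"
    by (intro has_sum_Re has_sum_bounded_linear[OF bounded_linear_cinner_right, unfolded o_def])
  moreover have "Re (cinner y y) = (norm y)\<^sup>2"
    unfolding cinner_self_norm by simp
  ultimately have *: "((\<lambda>c. (norm (p t c y))\<^sup>2) has_sum (norm y)\<^sup>2) (\<Gamma> t)"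
    using has_sum_cong[of "\<Gamma> t" "\<lambda>c. (norm (p t c y))\<^sup>2" "\<lambda>c. Re (cinner y (p t c y))"]
      norm_is_projection[OF projection[OF t]] by metis
  have "(\<Sum>c\<in>{a, b}. (norm (p t c y))\<^sup>2) \<le> (norm y)\<^sup>2"
    by (rule finite_sum_le_has_sum[OF *]) (use a b in auto)
  with ab y show ?thesis by (simp add: y_def)
qed

text \<open>Lists of pairs \<open>(t, a)\<close> may repeat or contradict themselves (\<open>a \<noteq> b\<close> for the same \<open>t\<close>):
  then \<open>Q\<close> vanishes on \<open>H\<^sub>\<pi>\<close> and the cylinder is empty, so both stay closed under concatenation.\<close>
definition Q :: "('s \<times> 'b) list \<Rightarrow> 'h \<Rightarrow> 'h" where
  "Q L = op_prod (map (\<lambda>(t, a). p t a) L)"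

abbreviation valid :: "('s \<times> 'b) list \<Rightarrow> bool" where
  "valid L \<equiv> set L \<subseteq> Sigma S \<Gamma>"

abbreviation "\<pi> \<equiv> pi_set S \<Gamma> p"

abbreviation "Hpi \<equiv> H_pi \<pi>"

lemma is_projection_pi: "W \<in> \<pi> \<Longrightarrow> is_projection W"
  using projection by (auto simp: pi_set_def)

lemma bounded_clinear_pi: "W \<in> \<pi> \<Longrightarrow> bounded_clinear W"
  using is_projection_pi is_projection_def by blast

lemma Q_Nil [simp]: "Q [] x = x"
  by (simp add: Q_def)

lemma Q_Cons [simp]: "Q (z # L) x = p (fst z) (snd z) (Q L x)"
  by (simp add: Q_def case_prod_beta)

lemma Q_append: "Q (L @ M) x = Q L (Q M x)"
  by (simp add: Q_def)

lemma valid_pi: "valid L \<Longrightarrow> set (map (\<lambda>(t, a). p t a) L) \<subseteq> \<pi>"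
  by (fastforce simp: pi_set_def)

lemma bounded_linear_Q: "valid L \<Longrightarrow> bounded_linear (Q L)"
  unfolding Q_def
  by (rule bounded_clinear_op_prod) (metis bounded_clinear_pi subsetD valid_pi)

lemma cinner_Q_left: "valid L \<Longrightarrow> cinner (Q L x) y = cinner x (Q (rev L) y)"
  unfolding Q_def rev_map[symmetric]
  by (rule cinner_op_prod_left) (metis is_projection_pi subsetD valid_pi)

section \<open>The commuting subspace\<close>

lemma csubspace_Hpi: "csubspace Hpi"
  unfolding csubspace_def
proof (intro conjI ballI allI)
  have "op_prod Ws 0 = 0" if "set Ws \<subseteq> \<pi>" for Ws
    using bounded_clinear_op_prod(1)[of Ws] bounded_clinear_pi that
    by (metis bounded_linear.linear linear_0 subsetD)
  then show "0 \<in> Hpi" by (simp add: H_pi_def commutes_on_def)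
next
  fix x y assume "x \<in> Hpi" "y \<in> Hpi"
  moreover have "op_prod Ws (x + y) = op_prod Ws x + op_prod Ws y" if "set Ws \<subseteq> \<pi>" for Ws
    using bounded_clinear_op_prod(1)[of Ws] bounded_clinear_pi that
    by (metis bounded_linear.linear linear_add subsetD)
  ultimately show "x + y \<in> Hpi"
    unfolding H_pi_def commutes_on_def mem_Collect_eq by metis
next
  fix c x assume "x \<in> Hpi"
  moreover have "op_prod Ws (scaleC c x) = scaleC c (op_prod Ws x)" if "set Ws \<subseteq> \<pi>" for Ws
    using bounded_clinear_op_prod(2)[of Ws] bounded_clinear_pi that by blast
  ultimately show "scaleC c x \<in> Hpi"
    unfolding H_pi_def commutes_on_def mem_Collect_eq by metis
qed

text \<open>An intersection of equalizers of continuous operators.\<close>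

lemma closed_Hpi: "closed Hpi"
proof -
  have "closed {x. op_prod Ws x = op_prod Vs x}" if "set Ws \<subseteq> \<pi>" "set Vs \<subseteq> \<pi>" for Ws Vs
    using that bounded_clinear_pi
    by (intro closed_Collect_eq linear_continuous_on bounded_clinear_op_prod(1)) blast+
  moreover have "Hpi = \<Inter> {{x. op_prod Ws x = op_prod Vs x} | Ws Vs.
      set Ws \<subseteq> \<pi> \<and> set Vs \<subseteq> \<pi> \<and> mset Ws = mset Vs}"
    unfolding H_pi_def commutes_on_def by blast
  ultimately show ?thesis by (smt (verit) closed_Inter mem_Collect_eq)
qed

lemma Q_perm:
  assumes "x \<in> Hpi" "valid L" "mset L = mset M"
  shows "Q L x = Q M x"
proof -
  have "set M = set L" using assms(3) by (metis set_mset_mset)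
  then show ?thesis
    using assms valid_pi[of L] valid_pi[of M] mset_map
    unfolding H_pi_def commutes_on_def Q_def mem_Collect_eq by metis
qed

text \<open>Appending the factors of \<open>L\<close> to both words turns the claim into commutation
  on \<open>x\<close> itself.\<close>

lemma Q_in_Hpi:
  assumes x: "x \<in> Hpi" and L: "valid L"
  shows "Q L x \<in> Hpi"
  unfolding H_pi_def commutes_on_def mem_Collect_eq
proof (intro allI impI)
  fix Ws Vs assume W: "set Ws \<subseteq> \<pi>" "set Vs \<subseteq> \<pi>" "mset Ws = mset Vs"
  define M where "M = map (\<lambda>(t, a). p t a) L"
  have "set (Ws @ M) \<subseteq> \<pi>" "set (Vs @ M) \<subseteq> \<pi>" "mset (Ws @ M) = mset (Vs @ M)"
    using W valid_pi[OF L] by (auto simp: M_def)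
  then have "op_prod (Ws @ M) x = op_prod (Vs @ M) x"
    using x unfolding H_pi_def commutes_on_def by blast
  then show "op_prod Ws (Q L x) = op_prod Vs (Q L x)" by (simp add: Q_def M_def)
qed

lemma Q_commute: "x \<in> Hpi \<Longrightarrow> valid L \<Longrightarrow> valid M \<Longrightarrow> Q L (Q M x) = Q M (Q L x)"
  using Q_perm[of x "L @ M" "M @ L"] by (simp add: Q_append)

lemma Q_rev: "x \<in> Hpi \<Longrightarrow> valid L \<Longrightarrow> Q (rev L) x = Q L x"
  by (rule Q_perm) auto

text \<open>On \<open>x\<close> any factor can be moved to the front of the product, where
  idempotence absorbs it.\<close>

lemma Q_member:
  assumes x: "x \<in> Hpi" and L: "valid L" and ta: "(t, a) \<in> set L"
  shows "p t a (Q L x) = Q L x"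
proof -
  obtain M N where "L = M @ (t, a) # N" using ta split_list by metis
  then have "Q L x = Q ((t, a) # M @ N) x" by (intro Q_perm x L) simp
  moreover have "is_projection (p t a)" using L ta projection by blast
  ultimately show ?thesis by (simp add: is_projectionD(1))
qed

lemma Q_fixed: "(\<And>t a. (t, a) \<in> set L \<Longrightarrow> p t a v = v) \<Longrightarrow> Q L v = v"
  by (induction L) auto

lemma Q_idem: "x \<in> Hpi \<Longrightarrow> valid L \<Longrightarrow> Q L (Q L x) = Q L x"
  by (intro Q_fixed Q_member)

text \<open>The adjoint of \<open>Q L\<close> is the product in reverse order, which agrees with
  \<open>Q L\<close> on \<open>Hpi\<close>.\<close>

lemma cinner_Q: "y \<in> Hpi \<Longrightarrow> valid L \<Longrightarrow> cinner (Q L x) y = cinner x (Q L y)"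
  by (simp add: cinner_Q_left Q_rev)

text \<open>On \<open>Hpi\<close> the product acts as an orthogonal projection, so this is
  Pythagoras.\<close>

lemma norm_diff_Q:
  assumes x: "x \<in> Hpi" and L: "valid L"
  shows "(norm (x - Q L x))\<^sup>2 = (norm x)\<^sup>2 - (norm (Q L x))\<^sup>2"
proof -
  have "cinner x (Q L x) = cinner (Q L x) (Q L x)"
    using cinner_Q[OF Q_in_Hpi[OF x L] L, of x] by (simp add: Q_idem x L)
  then have "Re (cinner x (Q L x)) = (norm (Q L x))\<^sup>2" unfolding cinner_self_norm by simp
  then show ?thesis by (simp add: norm_diff_square)
qed

lemma Q_inconsistent:
  assumes x: "x \<in> Hpi" and L: "valid L" and "(t, a) \<in> set L" "(t, b) \<in> set L" "a \<noteq> b"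
  shows "Q L x = 0"
proof -
  have "p t b (p t a (Q L x)) = 0" using assms by (intro projections_orthogonal) auto
  then show ?thesis using assms by (simp add: Q_member)
qed

section \<open>Annihilation along cylinders and the subspace \<open>F_set\<close>\<close>

text \<open>The condition \<open>wedge p T \<omega> x = 0\<close> of \<open>F_set\<close>, phrased without the projection itself.\<close>
definition annihilates :: "('s \<times> 'b) list \<Rightarrow> 'h \<Rightarrow> bool" where
  "annihilates L x \<longleftrightarrow> (\<forall>v. (\<forall>(t, a)\<in>set L. p t a v = v) \<longrightarrow> cinner x v = 0)"

definition cyl :: "('s \<times> 'b) list \<Rightarrow> ('s \<Rightarrow> 'b) set" where
  "cyl L = {\<omega> \<in> Omega S \<Gamma>. \<forall>(t, a)\<in>set L. \<omega> t = a}"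

lemma wedge_alt:
  assumes "T \<subseteq> S" "a \<in> Pi T \<Gamma>"
  shows "wedge p T a = proj_onto {v. \<forall>t\<in>T. p t (a t) v = v}"
proof -
  have "range (p t (a t)) = {v. p t (a t) v = v}" if "t \<in> T" for t
    using that assms by (intro range_is_projection projection) auto
  then have "(\<Inter>t\<in>T. range (p t (a t))) = {v. \<forall>t\<in>T. p t (a t) v = v}" by auto
  then show ?thesis by (simp add: wedge_def)
qed

lemma fixed_space:
  assumes "T \<subseteq> S" "a \<in> Pi T \<Gamma>"
  shows "csubspace {v. \<forall>t\<in>T. p t (a t) v = v}" "closed {v. \<forall>t\<in>T. p t (a t) v = v}"
proof -
  have pr: "is_projection (p t (a t))" if "t \<in> T" for t
    using that assms by (intro projection) auto
  show "csubspace {v. \<forall>t\<in>T. p t (a t) v = v}"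
    using is_projectionD(3,4)[OF pr] linear_0[OF bounded_linear.linear[OF is_projectionD(5)[OF pr]]]
    by (simp add: csubspace_def)
  have "{v. \<forall>t\<in>T. p t (a t) v = v} = (\<Inter>t\<in>T. {v. p t (a t) v = v})" by auto
  moreover have "closed {v. p t (a t) v = v}" if "t \<in> T" for t
    by (intro closed_Collect_eq linear_continuous_on is_projectionD(5) pr that continuous_on_id)
  ultimately show "closed {v. \<forall>t\<in>T. p t (a t) v = v}" by auto
qed

text \<open>Links the probabilities, which are given by \<open>wedge\<close>, to products. Each
  factor fixes \<open>Q L x\<close>, so it lies in the intersection; the adjoint product fixes every
  vector of the intersection, so the remainder is orthogonal to it.\<close>

lemma wedge_eq_Q:
  assumes x: "x \<in> Hpi" and T: "T \<subseteq> S" "a \<in> Pi T \<Gamma>" and L: "set L = (\<lambda>t. (t, a t)) ` T"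
  shows "wedge p T a x = Q L x"
  unfolding wedge_alt[OF T]
proof (rule proj_onto_eqI)
  have valid: "valid L" using T L by auto
  then show "Q L x \<in> {v. \<forall>t\<in>T. p t (a t) v = v}" using x L by (auto intro!: Q_member)
  fix v assume "v \<in> {v. \<forall>t\<in>T. p t (a t) v = v}"
  then have "Q (rev L) v = v" using L by (intro Q_fixed) auto
  then show "cinner (x - Q L x) v = 0" by (simp add: cinner_diff_left cinner_Q_left valid)
qed (rule fixed_space[OF T])

text \<open>A set \<open>T\<close> of times together with \<omega> and a list whose cylinder
  contains \<omega> carry the same data. The list form suits products of projections and covers by
  cylinders.\<close>

lemma F_set_iff:
  assumes "A \<subseteq> Omega S \<Gamma>"
  shows "x \<in> F_set S p A \<longleftrightarrow> (\<forall>\<omega>\<in>A. \<exists>L. valid L \<and> \<omega> \<in> cyl L \<and> annihilates L x)"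
proof -
  have "(\<exists>T. finite T \<and> T \<subseteq> S \<and> wedge p T \<omega> x = 0) \<longleftrightarrow>
      (\<exists>L. valid L \<and> \<omega> \<in> cyl L \<and> annihilates L x)" (is "?l \<longleftrightarrow> ?r") if "\<omega> \<in> A" for \<omega>
  proof -
    have \<omega>: "\<omega> \<in> Omega S \<Gamma>" using that assms by auto
    have *: "wedge p T \<omega> x = 0 \<longleftrightarrow> (\<forall>v. (\<forall>t\<in>T. p t (\<omega> t) v = v) \<longrightarrow> cinner x v = 0)"
      if "T \<subseteq> S" for T
    proof -
      have a: "\<omega> \<in> Pi T \<Gamma>" using \<omega> that by (auto simp: Omega_def)
      show ?thesis
        unfolding wedge_alt[OF that a] proj_onto_eq_0_iff[OF fixed_space[OF that a]]
        by (simp add: orth_def)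
    qed
    have "?r" if T: "finite T" "T \<subseteq> S" "wedge p T \<omega> x = 0" for T
    proof -
      obtain L where L: "set L = (\<lambda>t. (t, \<omega> t)) ` T"
        using finite_list[OF finite_imageI[OF T(1)]] by metis
      have "valid L \<and> \<omega> \<in> cyl L" using T(2) \<omega> by (auto simp: L Omega_def cyl_def)
      moreover have "annihilates L x" using T *[OF T(2)] by (simp add: annihilates_def L)
      ultimately show ?r by blast
    qed
    moreover have "?l" if L: "valid L" "\<omega> \<in> cyl L" "annihilates L x" for L
    proof -
      have "(\<forall>(t, a)\<in>set L. p t a v = v) \<longleftrightarrow> (\<forall>t\<in>fst ` set L. p t (\<omega> t) v = v)" for v
        using L(2) by (simp add: cyl_def case_prod_beta cong: ball_cong)
      moreover have T: "fst ` set L \<subseteq> S" using L(1) by auto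
      ultimately have "wedge p (fst ` set L) \<omega> x = 0"
        using L(3) unfolding *[OF T] annihilates_def by simp
      with T show ?l by (intro exI[of _ "fst ` set L"]) simp
    qed
    ultimately show ?thesis by metis
  qed
  then show ?thesis by (simp add: F_set_def)
qed

lemma annihilates_append:
  assumes "annihilates L x" "annihilates M y"
  shows "annihilates (L @ M) (x + y)"
  using assms by (simp add: annihilates_def cinner_add_left ball_Un)

text \<open>The adjoint product fixes every common fixed vector \<open>v\<close>, so
  \<open>cinner x v\<close> equals \<open>cinner (Q L x) v\<close>.\<close>

lemma annihilates_if_Q_eq_0:
  assumes "valid L" "Q L x = 0"
  shows "annihilates L x"
  unfolding annihilates_def
proof (intro allI impI)
  fix v assume "\<forall>(t, a)\<in>set L. p t a v = v"
  then have "Q (rev L) v = v" by (intro Q_fixed) auto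
  then show "cinner x v = 0" using cinner_Q_left[OF assms(1), of x v] assms(2) by simp
qed

lemma annihilates_Q:
  assumes "annihilates L x" "y \<in> Hpi" "valid L"
  shows "cinner x (Q L y) = 0"
  using assms Q_member[OF assms(2,3)] unfolding annihilates_def by blast

lemma csubspace_F_set:
  assumes A: "A \<subseteq> Omega S \<Gamma>"
  shows "csubspace (F_set S p A)"
  unfolding csubspace_def
proof (intro conjI ballI allI)
  have "annihilates [] 0" by (simp add: annihilates_def)
  moreover have "valid []" "\<omega> \<in> cyl []" if "\<omega> \<in> A" for \<omega> using A that by (auto simp: cyl_def)
  ultimately show "0 \<in> F_set S p A" unfolding F_set_iff[OF A] by blast
next
  fix x y assume xy: "x \<in> F_set S p A" "y \<in> F_set S p A"
  show "x + y \<in> F_set S p A"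
    unfolding F_set_iff[OF A]
  proof
    fix \<omega> assume "\<omega> \<in> A"
    with xy obtain L M where "valid L" "\<omega> \<in> cyl L" "annihilates L x"
      "valid M" "\<omega> \<in> cyl M" "annihilates M y"
      unfolding F_set_iff[OF A] by blast
    then have "valid (L @ M)" "\<omega> \<in> cyl (L @ M)" "annihilates (L @ M) (x + y)"
      by (auto simp: cyl_def intro: annihilates_append)
    then show "\<exists>L. valid L \<and> \<omega> \<in> cyl L \<and> annihilates L (x + y)" by blast
  qed
next
  fix c x assume "x \<in> F_set S p A"
  moreover have "annihilates L (scaleC c x)" if "annihilates L x" for L
    using that by (simp add: annihilates_def cinner_scaleC_left)
  ultimately show "scaleC c x \<in> F_set S p A" unfolding F_set_iff[OF A] by blast
qed

text \<open>Test \<open>x\<close> against the differences of the adjoint products, applied to an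
  arbitrary \<open>y\<close>. They lie in \<open>F_set\<close>: given \<omega>, every factor acts as
  the identity or as zero on the common range of the projections that \<omega> selects at the times
  involved.\<close>

lemma orth_F_set_subset_Hpi:
  assumes A: "A \<subseteq> Omega S \<Gamma>"
  shows "orth (F_set S p A) \<subseteq> Hpi"
proof
  fix x assume x: "x \<in> orth (F_set S p A)"
  show "x \<in> Hpi"
    unfolding H_pi_def commutes_on_def mem_Collect_eq
  proof (intro allI impI)
    fix Ws Vs assume W: "set Ws \<subseteq> \<pi>" "set Vs \<subseteq> \<pi>" "mset Ws = mset Vs"
    have sets: "set Ws = set Vs" using W(3) by (metis set_mset_mset)
    have "\<exists>t a. t \<in> S \<and> a \<in> \<Gamma> t \<and> W = p t a" if "W \<in> set Ws" for W
      using that W(1) unfolding pi_set_def by blast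
    \<comment> \<open>An operator can come from several pairs \<open>(t, a)\<close>; one pair is
      fixed for each.\<close>
    then obtain t a where ta: "\<And>W. W \<in> set Ws \<Longrightarrow> t W \<in> S \<and> a W \<in> \<Gamma> (t W) \<and> W = p (t W) (a W)"
      by metis
    have "cinner x (op_prod (rev Ws) y - op_prod (rev Vs) y) = 0" for y
    proof -
      have "op_prod (rev Ws) y - op_prod (rev Vs) y \<in> F_set S p A"
        unfolding F_set_iff[OF A]
      proof
        fix \<omega> assume "\<omega> \<in> A"
        then have \<omega>: "\<omega> \<in> Omega S \<Gamma>" using A by auto
        \<comment> \<open>The list uses the outcome of \<omega>, not the outcome \<open>a W\<close>
          of the factor, so that its cylinder contains \<omega>. A factor with a different outcome
          vanishes on \<open>v\<close>.\<close>
        define L where "L = map (\<lambda>W. (t W, \<omega> (t W))) Ws"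
        have "valid L" "\<omega> \<in> cyl L" using \<omega> ta by (auto simp: L_def Omega_def cyl_def)
        moreover have "annihilates L (op_prod (rev Ws) y - op_prod (rev Vs) y)"
          unfolding annihilates_def
        proof (intro allI impI)
          fix v assume v: "\<forall>(t, a)\<in>set L. p t a v = v"
          \<comment> \<open>\<open>v\<close> is a common eigenvector of all factors, so their order is irrelevant on it.\<close>
          have "W v = v \<or> W v = 0" if W: "W \<in> set Ws" for W
          proof (cases "a W = \<omega> (t W)")
            case True
            with v ta[OF W] W show ?thesis by (auto simp: L_def)
          next
            case False
            have "W (p (t W) (\<omega> (t W)) v) = 0"
              using projections_orthogonal[of "t W" "\<omega> (t W)" "a W" v] False ta[OF W] \<omega>
              by (auto simp: Omega_def)
            with v W show ?thesis by (auto simp: L_def)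
          qed
          moreover have "W 0 = 0" if "W \<in> set Ws" for W
            using that W(1) is_projection_pi is_projectionD(5) bounded_linear.linear linear_0
            by (metis subsetD)
          ultimately have "op_prod Ws v = op_prod Vs v"
            using op_prod_eigenvector[of Ws v] op_prod_eigenvector[of Vs v] sets by simp
          moreover have "cinner (op_prod (rev Us) y) v = cinner y (op_prod Us v)"
            if "set Us \<subseteq> \<pi>" for Us
            using cinner_op_prod_left[of "rev Us" y v] that is_projection_pi by auto
          ultimately show "cinner (op_prod (rev Ws) y - op_prod (rev Vs) y) v = 0"
            using W by (simp add: cinner_diff_left)
        qed
        ultimately show "\<exists>L. valid L \<and> \<omega> \<in> cyl L \<and>
            annihilates L (op_prod (rev Ws) y - op_prod (rev Vs) y)" by blast
      qed
      with x show ?thesis by (simp add: orth_def)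
    qed
    moreover have "cinner x (op_prod (rev Us) y) = cinner (op_prod Us x) y"
      if "set Us \<subseteq> \<pi>" for Us y
      using cinner_op_prod_left[of Us x y] that is_projection_pi by (metis subsetD)
    ultimately have "cinner (op_prod Ws x - op_prod Vs x) y = 0" for y
      using W by (simp add: cinner_diff_left cinner_diff_right)
    then show "op_prod Ws x = op_prod Vs x" by (metis cinner_self_eq_0 eq_iff_diff_eq_0)
  qed
qed

subsection \<open>Outer regularity with respect to cylinders\<close>

lemma cyl_Nil [simp]: "cyl [] = Omega S \<Gamma>"
  by (simp add: cyl_def)

lemma mem_cylD: "\<omega> \<in> cyl L \<Longrightarrow> (t, a) \<in> set L \<Longrightarrow> \<omega> t = a"
  by (auto simp: cyl_def)

lemma cyl_append: "cyl (L @ M) = cyl L \<inter> cyl M"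
  unfolding cyl_def set_append ball_Un by auto

lemma cyl_subset: "cyl L \<subseteq> Omega S \<Gamma>"
  by (auto simp: cyl_def)

lemma sigma_algebra_Sigma_alg: "sigma_algebra (Omega S \<Gamma>) (Sigma_alg S \<Gamma>)"
  unfolding Sigma_alg_def by (rule sigma_algebra_sigma_sets) auto

sublocale sigma_algebra "Omega S \<Gamma>" "Sigma_alg S \<Gamma>"
  by (rule sigma_algebra_Sigma_alg)

lemma cyl_sets: "valid L \<Longrightarrow> cyl L \<in> Sigma_alg S \<Gamma>"
proof (induction L)
  case (Cons z L)
  obtain t a where z: "z = (t, a)" by fastforce
  have "{\<omega> \<in> Omega S \<Gamma>. \<omega> t = a} \<in> Sigma_alg S \<Gamma>"
    unfolding Sigma_alg_def using Cons.prems z by (intro sigma_sets.Basic) auto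
  moreover have "cyl (z # L) = {\<omega> \<in> Omega S \<Gamma>. \<omega> t = a} \<inter> cyl L" by (auto simp: cyl_def z)
  ultimately show ?case using Cons by auto
qed auto

lemma Sigma_alg_eq_cyl: "Sigma_alg S \<Gamma> = sigma_sets (Omega S \<Gamma>) (cyl ` {L. valid L})"
proof
  have "{\<omega> \<in> Omega S \<Gamma>. \<omega> t = a} = cyl [(t, a)]" for t a by (auto simp: cyl_def)
  then have "{{\<omega> \<in> Omega S \<Gamma>. \<omega> t = a} | t a. t \<in> S \<and> a \<in> \<Gamma> t} \<subseteq> cyl ` {L. valid L}"
    by fastforce
  then show "Sigma_alg S \<Gamma> \<subseteq> sigma_sets (Omega S \<Gamma>) (cyl ` {L. valid L})"
    unfolding Sigma_alg_def by (rule sigma_sets_mono')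
  show "sigma_sets (Omega S \<Gamma>) (cyl ` {L. valid L}) \<subseteq> Sigma_alg S \<Gamma>"
    by (rule sigma_sets_subset) (auto intro: cyl_sets)
qed

text \<open>Takes the place of the open sets of the product. Restricting to countable unions keeps
  these sets measurable when \<open>S\<close> is uncountable.\<close>

definition cyl_open :: "('s \<Rightarrow> 'b) set \<Rightarrow> bool" where
  "cyl_open U \<longleftrightarrow> (\<exists>\<L>. countable \<L> \<and> \<L> \<subseteq> {L. valid L} \<and> U = (\<Union>L\<in>\<L>. cyl L))"

lemma cyl_open_sets: "cyl_open U \<Longrightarrow> U \<in> Sigma_alg S \<Gamma>"
  unfolding cyl_open_def by (auto intro!: countable_UN' cyl_sets)

lemma cyl_open_cyl: "valid L \<Longrightarrow> cyl_open (cyl L)"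
  unfolding cyl_open_def by (intro exI[of _ "{L}"]) auto

lemma cyl_open_UN:
  assumes "countable I" "\<And>i. i \<in> I \<Longrightarrow> cyl_open (U i)"
  shows "cyl_open (\<Union>i\<in>I. U i)"
proof -
  obtain \<L> where \<L>: "\<And>i. i \<in> I \<Longrightarrow> countable (\<L> i) \<and> \<L> i \<subseteq> {L. valid L} \<and> U i = (\<Union>L\<in>\<L> i. cyl L)"
    using assms(2) unfolding cyl_open_def by metis
  show ?thesis
    unfolding cyl_open_def
  proof (intro exI conjI)
    show "countable (\<Union>i\<in>I. \<L> i)" using \<L> assms(1) by auto
    show "(\<Union>i\<in>I. \<L> i) \<subseteq> {L. valid L}" using \<L> by blast
    show "(\<Union>i\<in>I. U i) = (\<Union>L\<in>(\<Union>i\<in>I. \<L> i). cyl L)" using \<L> by auto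
  qed
qed

lemma cyl_open_Int:
  assumes "cyl_open U" "cyl_open V"
  shows "cyl_open (U \<inter> V)"
proof -
  obtain \<L> \<M> where \<L>: "countable \<L>" "\<L> \<subseteq> {L. valid L}" "U = (\<Union>L\<in>\<L>. cyl L)"
    and \<M>: "countable \<M>" "\<M> \<subseteq> {L. valid L}" "V = (\<Union>L\<in>\<M>. cyl L)"
    using assms unfolding cyl_open_def by blast
  have "U \<inter> V = (\<Union>(L, M)\<in>\<L> \<times> \<M>. cyl (L @ M))" by (auto simp: \<L> \<M> cyl_append)
  moreover have "cyl_open \<dots>"
  proof (rule cyl_open_UN)
    fix z assume "z \<in> \<L> \<times> \<M>"
    then have "fst z \<in> {L. valid L}" "snd z \<in> {L. valid L}"
      using \<L>(2) \<M>(2) by (metis mem_Times_iff subsetD)+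
    then have "valid (fst z @ snd z)" by simp
    then show "cyl_open (case z of (L, M) \<Rightarrow> cyl (L @ M))"
      unfolding case_prod_beta by (rule cyl_open_cyl)
  qed (use \<L> \<M> in auto)
  ultimately show ?thesis by simp
qed

lemma cyl_open_finite_INT:
  "(\<And>n::nat. cyl_open (V n)) \<Longrightarrow> cyl_open (Omega S \<Gamma> \<inter> (\<Inter>n<N. V n))"
proof (induction N)
  case 0
  then show ?case using cyl_open_cyl[of "[]"] by simp
next
  case (Suc N)
  have "Omega S \<Gamma> \<inter> (\<Inter>n<Suc N. V n) = (Omega S \<Gamma> \<inter> (\<Inter>n<N. V n)) \<inter> V N"
    by (auto simp: lessThan_Suc)
  then show ?case using Suc cyl_open_Int by simp
qed

text \<open>Approximating \<open>A\<close> and its complement from outside at the same time makes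
  the induction over \<open>sigma_sets\<close> symmetric: complementation merely swaps
  \<open>U\<close> and \<open>V\<close>.\<close>

lemma cyl_regular:
  assumes M: "finite_measure M" and sets_M: "sets M = Sigma_alg S \<Gamma>"
    and "A \<in> Sigma_alg S \<Gamma>" "0 < (e::real)"
  shows "\<exists>U V. cyl_open U \<and> cyl_open V \<and> A \<subseteq> U \<and> Omega S \<Gamma> - A \<subseteq> V \<and> measure M (U \<inter> V) < e"
  using assms(3)[unfolded Sigma_alg_def] assms(4)
proof (induction A arbitrary: e rule: sigma_sets.induct)
  case (Basic A)
  then obtain t a where ta: "t \<in> S" "a \<in> \<Gamma> t" and A: "A = {\<omega> \<in> Omega S \<Gamma>. \<omega> t = a}" by blast
  \<comment> \<open>The other outcomes at \<open>t\<close> are countably many, so the complement of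
    \<open>A\<close> is \<open>cyl_open\<close> too and there is no overlap.\<close>
  define V where "V = (\<Union>b\<in>\<Gamma> t - {a}. cyl [(t, b)])"
  have "A = cyl [(t, a)]" by (auto simp: A cyl_def)
  then have "cyl_open A" using ta by (auto intro: cyl_open_cyl)
  moreover have "cyl_open V"
    unfolding V_def using ta countable_outcomes[OF ta(1)] by (intro cyl_open_UN cyl_open_cyl) auto
  moreover have "Omega S \<Gamma> - A \<subseteq> V" using ta by (auto simp: A V_def cyl_def Omega_def)
  moreover have "A \<inter> V = {}" by (auto simp: A V_def cyl_def)
  ultimately show ?case using Basic.prems by (intro exI[of _ A] exI[of _ V]) auto
next
  case Empty
  have "cyl_open {}" unfolding cyl_open_def by (intro exI[of _ "{}"]) auto
  with Empty show ?case using cyl_open_cyl[of "[]"]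
    by (intro exI[of _ "{}"] exI[of _ "Omega S \<Gamma>"]) auto
next
  case (Compl A)
  then obtain U V where "cyl_open U" "cyl_open V" "A \<subseteq> U" "Omega S \<Gamma> - A \<subseteq> V" "measure M (U \<inter> V) < e"
    by blast
  then show ?case by (intro exI[of _ V] exI[of _ U]) (auto simp: Int_commute)
next
  case (Union A)
  interpret M: finite_measure M by (rule M)
  \<comment> \<open>One half of \<open>e\<close> is shared out geometrically among the overlaps; the
    other half is kept for truncating the union.\<close>
  have "0 < e / 2 * (1 / 2) ^ Suc n" for n using Union.prems by simp
  then have "\<exists>U V. cyl_open U \<and> cyl_open V \<and> A n \<subseteq> U \<and> Omega S \<Gamma> - A n \<subseteq> V \<and>
      measure M (U \<inter> V) < e / 2 * (1 / 2) ^ Suc n" for n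
    by (rule Union.IH)
  then obtain U V where UV: "\<And>n. cyl_open (U n)" "\<And>n. cyl_open (V n)" "\<And>n. A n \<subseteq> U n"
      "\<And>n. Omega S \<Gamma> - A n \<subseteq> V n" "\<And>n. measure M (U n \<inter> V n) < e / 2 * (1 / 2) ^ Suc n"
    by metis
  have sets: "U n \<in> sets M" "V n \<in> sets M" for n using UV(1,2) cyl_open_sets sets_M by auto
  define W where "W = (\<Union>n. U n)"
  define B where "B N = (\<Union>n<N. U n)" for N
  have B: "B N \<in> sets M" for N using sets by (auto simp: B_def)
  have W: "W \<in> sets M" using sets by (auto simp: W_def)
  have "(\<lambda>N. measure M (B N)) \<longlonglongrightarrow> measure M (\<Union>N. B N)"
  proof (rule M.finite_Lim_measure_incseq)
    show "incseq B" unfolding B_def by (intro monoI UN_mono) auto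
  qed (use B in auto)
  moreover have "(\<Union>N. B N) = W" by (auto simp: B_def W_def)
  ultimately have "\<forall>\<^sub>F N in sequentially. measure M (B N) > measure M W - e / 2"
    using Union.prems by (intro order_tendstoD) auto
  then obtain N where N: "measure M (B N) > measure M W - e / 2"
    using eventually_happens' sequentially_bot by blast
  \<comment> \<open>Countable intersections of \<open>cyl_open\<close> sets need not be
    \<open>cyl_open\<close>, so only the first \<open>N\<close> sets \<open>V n\<close> are
    intersected. The price is \<open>W - B N\<close>, of measure below \<open>e / 2\<close>.\<close>
  define X where "X = Omega S \<Gamma> \<inter> (\<Inter>n<N. V n)"
  have geo: "(\<Sum>n<N. (1 / 2 :: real) ^ Suc n) = 1 - (1 / 2) ^ N" by (induction N) auto
  have "measure M (\<Union>n<N. U n \<inter> V n) \<le> (\<Sum>n<N. measure M (U n \<inter> V n))"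
    using sets by (intro M.finite_measure_subadditive_finite) auto
  also have "\<dots> \<le> (\<Sum>n<N. e / 2 * (1 / 2) ^ Suc n)"
    using UV(5) by (intro sum_mono less_imp_le)
  also have "\<dots> = e / 2 * (1 - (1 / 2) ^ N)" by (simp only: geo flip: sum_distrib_left)
  also have "\<dots> \<le> e / 2" using Union.prems by (simp add: mult_left_le)
  finally have small: "measure M (\<Union>n<N. U n \<inter> V n) \<le> e / 2" .
  have "measure M (W - B N) = measure M W - measure M (B N)"
    by (rule M.finite_measure_Diff[OF W B]) (auto simp: B_def W_def)
  then have "measure M (W - B N) < e / 2" using N by simp
  \<comment> \<open>A point of \<open>W \<inter> X\<close> inside \<open>B N\<close> lies in some
    \<open>U n\<close> with \<open>n < N\<close>, and \<open>X\<close> puts it into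
    \<open>V n\<close> as well.\<close>
  moreover have "measure M (W \<inter> X) \<le> measure M ((W - B N) \<union> (\<Union>n<N. U n \<inter> V n))"
    using sets B W by (intro M.finite_measure_mono) (auto simp: B_def X_def)
  moreover have "\<dots> \<le> measure M (W - B N) + measure M (\<Union>n<N. U n \<inter> V n)"
    using sets B W by (intro measure_Un_le) auto
  ultimately have "measure M (W \<inter> X) < e" using small by linarith
  moreover have "cyl_open W" unfolding W_def using UV(1) by (intro cyl_open_UN) auto
  moreover have "cyl_open X" unfolding X_def using UV(2) by (rule cyl_open_finite_INT)
  moreover have "(\<Union>n. A n) \<subseteq> W" using UV(3) by (auto simp: W_def)
  moreover have "Omega S \<Gamma> - (\<Union>n. A n) \<subseteq> X" using UV(4) by (auto simp: X_def)
  ultimately show ?case by blast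
qed

text \<open>The part of \<open>U\<close> outside \<open>A\<close> lies in \<open>V\<close>, hence in
  the small overlap.\<close>

lemma cyl_outer_regular:
  assumes M: "finite_measure M" and sets_M: "sets M = Sigma_alg S \<Gamma>"
    and A: "A \<in> Sigma_alg S \<Gamma>" and e: "0 < (e::real)"
  obtains U where "cyl_open U" "A \<subseteq> U" "measure M U < measure M A + e"
proof -
  interpret M: finite_measure M by (rule M)
  obtain U V where UV: "cyl_open U" "cyl_open V" "A \<subseteq> U" "Omega S \<Gamma> - A \<subseteq> V" "measure M (U \<inter> V) < e"
    using cyl_regular[OF assms] by blast
  have sets: "U \<in> sets M" "V \<in> sets M" "A \<in> sets M"
    using UV(1,2) A by (auto simp: sets_M cyl_open_sets)
  have "U - A \<subseteq> U \<inter> V" using UV(4) sets_into_space[OF cyl_open_sets[OF UV(1)]] by auto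
  then have "measure M (U - A) < e"
    using UV(5) sets M.finite_measure_mono[of "U - A" "U \<inter> V"] by auto
  moreover have "measure M (U - A) = measure M U - measure M A"
    using sets UV(3) by (intro M.finite_measure_Diff) auto
  ultimately show ?thesis using that UV by auto
qed

section \<open>Compactness for finite outcome sets\<close>

lemma openin_cyl:
  assumes "valid L"
  shows "openin (product_topology (\<lambda>t. discrete_topology (\<Gamma> t)) S) (cyl L)"
  using assms
proof (induction L)
  case Nil
  then show ?case by (metis Omega_def cyl_Nil openin_topspace topspace_discrete_topology
        topspace_product_topology PiE_cong)
next
  case (Cons z L)
  obtain t a where z: "z = (t, a)" by fastforce
  let ?X = "product_topology (\<lambda>t. discrete_topology (\<Gamma> t)) S"
  have "openin ?X {\<omega> \<in> topspace ?X. \<omega> t \<in> {a}}"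
    using Cons.prems z
    by (intro openin_continuous_map_preimage[OF continuous_map_product_projection]) auto
  moreover have "cyl (z # L) = {\<omega> \<in> topspace ?X. \<omega> t \<in> {a}} \<inter> cyl L"
    by (auto simp: cyl_def z Omega_def)
  ultimately show ?case using Cons by auto
qed

text \<open>Tychonoff: a product of finite discrete spaces is compact, and cylinders are open in
  it.\<close>

lemma finite_cylinder_cover:
  assumes fin: "\<forall>t\<in>S. finite (\<Gamma> t)" and \<L>: "\<L> \<subseteq> {L. valid L}"
    and cover: "Omega S \<Gamma> \<subseteq> (\<Union>L\<in>\<L>. cyl L)"
  obtains \<F> where "finite \<F>" "\<F> \<subseteq> \<L>" "Omega S \<Gamma> \<subseteq> (\<Union>L\<in>\<F>. cyl L)"
proof -
  let ?X = "product_topology (\<lambda>t. discrete_topology (\<Gamma> t)) S"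
  have "compact_space ?X"
    using fin by (simp add: compact_space_product_topology compact_space_discrete_topology)
  moreover have "topspace ?X = Omega S \<Gamma>" by (simp add: Omega_def)
  moreover have "\<forall>U\<in>cyl ` \<L>. openin ?X U" using \<L> openin_cyl by blast
  ultimately obtain \<C> where "finite \<C>" "\<C> \<subseteq> cyl ` \<L>" "Omega S \<Gamma> \<subseteq> \<Union>\<C>"
    using cover unfolding compact_space_alt by metis
  then show ?thesis using that by (metis finite_subset_image)
qed

end

section \<open>The measures \<open>P\<^sub>\<phi>\<close>\<close>

locale pvm_prob = pvm_family S \<Gamma> p
  for S :: "'s set" and \<Gamma> :: "'s \<Rightarrow> 'b set" and p :: "'s \<Rightarrow> 'b \<Rightarrow> 'h::chilbert_space \<Rightarrow> 'h" +
  fixes P :: "'h \<Rightarrow> ('s \<Rightarrow> 'b) measure"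
  assumes P_family: "is_P_family S \<Gamma> p P"
begin

lemma P_props:
  assumes "x \<in> Hpi" "x \<noteq> 0"
  shows "prob_space (P x)" "space (P x) = Omega S \<Gamma>" "sets (P x) = Sigma_alg S \<Gamma>"
  using P_family assms unfolding is_P_family_def by blast+

text \<open>The unnormalised measure is additive along the decompositions below and is 0 at \<open>x = 0\<close>,
  where \<open>P x\<close> is unspecified.\<close>
definition nu :: "'h \<Rightarrow> ('s \<Rightarrow> 'b) set \<Rightarrow> real" where
  "nu x D = (norm x)\<^sup>2 * measure (P x) D"

lemma nu_zero [simp]: "nu 0 D = 0"
  by (simp add: nu_def)

lemma nu_empty [simp]: "nu x {} = 0"
  by (simp add: nu_def)

lemma nu_Omega: "x \<in> Hpi \<Longrightarrow> nu x (Omega S \<Gamma>) = (norm x)\<^sup>2"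
  using P_props[of x] prob_space.prob_space[of "P x"] by (cases "x = 0") (auto simp: nu_def)

lemma nu_sums:
  assumes "x \<in> Hpi" "range D \<subseteq> Sigma_alg S \<Gamma>" "disjoint_family D"
  shows "(\<lambda>n. nu x (D n)) sums nu x (\<Union>n. D n)"
proof (cases "x = 0")
  case False
  interpret prob_space "P x" using P_props[OF assms(1) False] by simp
  show ?thesis
    unfolding nu_def using assms P_props[OF assms(1) False]
    by (intro sums_mult finite_measure_UNION) auto
qed simp

lemma nu_Diff:
  assumes "x \<in> Hpi" "D \<in> Sigma_alg S \<Gamma>" "E \<in> Sigma_alg S \<Gamma>"
  shows "nu x (D - E) = nu x D - nu x (D \<inter> E)"
proof (cases "x = 0")
  case False
  interpret prob_space "P x" using P_props[OF assms(1) False] by simp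
  show ?thesis
    unfolding nu_def using assms P_props[OF assms(1) False]
    by (simp add: finite_measure_Diff' right_diff_distrib)
qed simp

lemma nu_mono:
  assumes "x \<in> Hpi" "D \<subseteq> E" "E \<in> Sigma_alg S \<Gamma>"
  shows "nu x D \<le> nu x E"
proof (cases "x = 0")
  case False
  interpret prob_space "P x" using P_props[OF assms(1) False] by simp
  show ?thesis
    unfolding nu_def using assms P_props[OF assms(1) False]
    by (intro mult_left_mono finite_measure_mono) auto
qed simp

text \<open>For consistent lists this is the defining property of \<open>P\<close>, with
  \<open>wedge\<close> replaced by \<open>Q\<close>; for contradictory lists both sides
  vanish.\<close>

lemma nu_cyl:
  assumes x: "x \<in> Hpi" and L: "valid L"
  shows "nu x (cyl L) = (norm (Q L x))\<^sup>2"
proof (cases "x = 0")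
  case True
  then show ?thesis using linear_0[OF bounded_linear.linear[OF bounded_linear_Q[OF L]]] by simp
next
  case x0: False
  show ?thesis
  proof (cases "\<exists>t a b. (t, a) \<in> set L \<and> (t, b) \<in> set L \<and> a \<noteq> b")
    case True
    then have "cyl L = {}" using mem_cylD by blast
    moreover have "Q L x = 0" using True Q_inconsistent[OF x L] by blast
    ultimately show ?thesis by simp
  next
    case False
    define T where "T = fst ` set L"
    define a where "a t = (THE b. (t, b) \<in> set L)" for t
    have a: "a t = b" if "(t, b) \<in> set L" for t b
      unfolding a_def using that False by (intro the_equality) blast+
    have L_eq: "set L = (\<lambda>t. (t, a t)) ` T" using a by (force simp: T_def)
    have T: "finite T" "T \<subseteq> S" "a \<in> Pi T \<Gamma>" using L a by (auto simp: T_def)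
    have "cyl L = {\<omega> \<in> Omega S \<Gamma>. \<forall>t\<in>T. \<omega> t = a t}" by (simp add: cyl_def L_eq)
    moreover have "measure (P x) {\<omega> \<in> Omega S \<Gamma>. \<forall>t\<in>T. \<omega> t = a t} = (norm (wedge p T a (sgn x)))\<^sup>2"
      using P_family x x0 T unfolding is_P_family_def by blast
    moreover have "wedge p T a (sgn x) = Q L (sgn x)"
      using x by (intro wedge_eq_Q T L_eq) (simp add: sgn_div_norm csubspace_scaleR csubspace_Hpi)
    moreover have "Q L (sgn x) = inverse (norm x) *\<^sub>R Q L x"
      unfolding sgn_div_norm by (rule linear_cmul[OF bounded_linear.linear[OF bounded_linear_Q[OF L]]])
    ultimately show ?thesis using x0 by (simp add: nu_def power_mult_distrib power_inverse)
  qed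
qed

text \<open>On cylinders this is Pythagoras. Both sides are finite measures in \<open>D\<close>, so
  the identity extends from the intersection-stable system of cylinders to the whole
  \<sigma>-algebra.\<close>

lemma nu_Diff_cyl:
  assumes x: "x \<in> Hpi" and L: "valid L" and D: "D \<in> Sigma_alg S \<Gamma>"
  shows "nu (x - Q L x) D = nu x (D - cyl L)"
proof -
  have y: "x - Q L x \<in> Hpi" by (intro csubspace_diff csubspace_Hpi x Q_in_Hpi L)
  have "Int_stable (cyl ` {L. valid L})"
    by (auto simp: Int_stable_def simp flip: cyl_append)
  moreover have "cyl ` {L. valid L} \<subseteq> Pow (Omega S \<Gamma>)" using cyl_subset by auto
  moreover have "D \<in> sigma_sets (Omega S \<Gamma>) (cyl ` {L. valid L})" using D Sigma_alg_eq_cyl by simp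
  ultimately show ?thesis
  proof (induction rule: sigma_sets_induct_disjoint)
    case (basic A)
    then obtain M where M: "valid M" "A = cyl M" by blast
    \<comment> \<open>\<open>Q L\<close> and \<open>Q M\<close> commute on \<open>x\<close>, so
      \<open>norm_diff_Q\<close> can be applied to the vector \<open>Q M x\<close>.\<close>
    have "Q M (x - Q L x) = Q M x - Q L (Q M x)"
      using linear_diff[OF bounded_linear.linear[OF bounded_linear_Q[OF M(1)]]] Q_commute[OF x L M(1)]
      by simp
    then have "nu (x - Q L x) (cyl M) = (norm (Q M x))\<^sup>2 - (norm (Q L (Q M x)))\<^sup>2"
      by (simp add: nu_cyl y M norm_diff_Q Q_in_Hpi x L)
    also have "\<dots> = nu x (cyl M) - nu x (cyl M \<inter> cyl L)"
      using nu_cyl[of x "L @ M"] L M by (simp add: nu_cyl x Q_append cyl_append Int_commute)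
    also have "\<dots> = nu x (cyl M - cyl L)" using M L by (simp add: nu_Diff x cyl_sets)
    finally show ?case by (simp add: M)
  next
    case empty
    then show ?case by simp
  next
    case (compl A)
    then have A: "A \<in> Sigma_alg S \<Gamma>" by (simp add: Sigma_alg_eq_cyl)
    have om: "Omega S \<Gamma> \<in> Sigma_alg S \<Gamma>" by (rule top)
    have sub: "A \<subseteq> Omega S \<Gamma>" by (rule sets_into_space[OF A])
    have "nu (x - Q L x) (Omega S \<Gamma> - A) = nu (x - Q L x) (Omega S \<Gamma>) - nu x (A - cyl L)"
      using nu_Diff[OF y om A] sub compl.IH by (simp add: Int_absorb1)
    \<comment> \<open>Complements need equality of the total masses, which is Pythagoras once
      more.\<close>
    also have "nu (x - Q L x) (Omega S \<Gamma>) = nu x (Omega S \<Gamma>) - nu x (cyl L)"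
      by (simp add: nu_Omega y x norm_diff_Q L nu_cyl)
    also have "\<dots> = nu x (Omega S \<Gamma> - cyl L)"
      using nu_Diff[OF x om cyl_sets[OF L]] cyl_subset by (simp add: Int_absorb1)
    also have "\<dots> - nu x (A - cyl L) = nu x ((Omega S \<Gamma> - cyl L) - (A - cyl L))"
      using nu_Diff[OF x Diff[OF om cyl_sets[OF L]] Diff[OF A cyl_sets[OF L]]] sub
      by (simp add: Int_absorb1 Diff_mono)
    also have "(Omega S \<Gamma> - cyl L) - (A - cyl L) = (Omega S \<Gamma> - A) - cyl L" by auto
    finally show ?case .
  next
    case (union A)
    then have A: "range A \<subseteq> Sigma_alg S \<Gamma>" by (simp add: Sigma_alg_eq_cyl)
    have "(\<lambda>n. nu (x - Q L x) (A n)) sums nu (x - Q L x) (\<Union>n. A n)"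
      by (rule nu_sums[OF y A union(1)])
    moreover have "(\<lambda>n. nu x (A n - cyl L)) sums nu x (\<Union>n. A n - cyl L)"
      using A union(1) cyl_sets[OF L]
      by (intro nu_sums x) (auto simp: disjoint_family_on_def)
    moreover have "(\<Union>n. A n - cyl L) = (\<Union>n. A n) - cyl L" by auto
    ultimately show ?case using union.IH by (simp add: sums_unique2)
  qed
qed

section \<open>Removing a sequence of cylinders\<close>

primrec residue :: "(nat \<Rightarrow> ('s \<times> 'b) list) \<Rightarrow> 'h \<Rightarrow> nat \<Rightarrow> 'h" where
  "residue C x 0 = x"
| "residue C x (Suc n) = residue C x n - Q (C n) (residue C x n)"

context
  fixes C :: "nat \<Rightarrow> ('s \<times> 'b) list" and x :: 'h
  assumes C: "\<And>n. valid (C n)" and x: "x \<in> Hpi"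
begin

lemma residue_Hpi: "residue C x n \<in> Hpi"
  by (induction n) (simp_all add: x C Q_in_Hpi csubspace_diff csubspace_Hpi)

text \<open>The induction runs over all \<open>D\<close>, since undoing the last removal replaces
  \<open>D\<close> by \<open>D - cyl (C n)\<close>.\<close>

lemma nu_residue: "D \<in> Sigma_alg S \<Gamma> \<Longrightarrow> nu (residue C x n) D = nu x (D - (\<Union>k<n. cyl (C k)))"
proof (induction n arbitrary: D)
  case (Suc n)
  then have "nu (residue C x (Suc n)) D = nu (residue C x n) (D - cyl (C n))"
    by (simp add: nu_Diff_cyl residue_Hpi C)
  also have "\<dots> = nu x (D - cyl (C n) - (\<Union>k<n. cyl (C k)))"
    using Suc cyl_sets[OF C] by (intro Suc.IH) auto
  also have "D - cyl (C n) - (\<Union>k<n. cyl (C k)) = D - (\<Union>k<Suc n. cyl (C k))"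
    by (auto simp: lessThan_Suc)
  finally show ?case .
qed simp

lemma norm_residue: "(norm (residue C x n))\<^sup>2 = nu x (Omega S \<Gamma> - (\<Union>k<n. cyl (C k)))"
  using nu_residue[OF top] nu_Omega[OF residue_Hpi] by simp

text \<open>Once removed, a cylinder stays removed, because the later operators commute with
  \<open>Q (C k)\<close> on \<open>Hpi\<close>.\<close>

lemma Q_residue: "k < n \<Longrightarrow> Q (C k) (residue C x n) = 0"
proof (induction n)
  case (Suc n)
  have lin: "linear (Q (C j))" for j by (rule bounded_linear.linear[OF bounded_linear_Q[OF C]])
  have "Q (C k) (residue C x (Suc n)) = Q (C k) (residue C x n) - Q (C n) (Q (C k) (residue C x n))"
    by (simp add: linear_diff[OF lin] Q_commute[OF residue_Hpi C C, of k n])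
  also have "\<dots> = 0"
    using Suc by (cases "k = n") (auto simp: Q_idem residue_Hpi C linear_0[OF lin])
  finally show ?case .
qed simp

text \<open>Each increment is in the image of some \<open>Q (C j)\<close> with \<open>j < k\<close>.
  Moved to the other side of the inner product, that operator annihilates the residue with index
  \<open>k\<close>.\<close>

lemma cinner_residue_diff: "m \<le> n \<Longrightarrow> n \<le> k \<Longrightarrow> cinner (residue C x m - residue C x n) (residue C x k) = 0"
proof (induction n rule: dec_induct)
  case (step n)
  have "cinner (Q (C n) (residue C x n)) (residue C x k) = 0"
    using step.prems by (simp add: cinner_Q residue_Hpi C Q_residue)
  then show ?case using step by (simp add: cinner_diff_left)
qed simp

lemma norm_residue_diff:
  assumes "m \<le> n"
  shows "(norm (residue C x m - residue C x n))\<^sup>2 = (norm (residue C x m))\<^sup>2 - (norm (residue C x n))\<^sup>2"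
  using norm_add_square[of "residue C x m - residue C x n" "residue C x n"]
    cinner_residue_diff[OF assms order_refl] by simp

text \<open>The squared norms of the residues decrease, and by Pythagoras their gaps are the squared
  distances, so the residues converge. The value of \<open>cinner x y\<close> says that
  \<open>y\<close> is orthogonal to \<open>x - y\<close>; it later forces \<open>y = 0\<close> when
  \<open>x\<close> is orthogonal to \<open>F_set\<close>.\<close>

lemma residue_limit:
  obtains y where "y \<in> Hpi" "\<forall>k. Q (C k) y = 0" "cinner x y = of_real ((norm y)\<^sup>2)"
    "(norm (x - y))\<^sup>2 \<le> nu x (\<Union>k. cyl (C k))"
proof -
  let ?r = "residue C x"
  have "decseq (\<lambda>n. (norm (?r n))\<^sup>2)"
  proof (rule decseq_SucI)
    fix n
    have "0 \<le> (norm (?r n - ?r (Suc n)))\<^sup>2" by simp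
    then show "(norm (?r (Suc n)))\<^sup>2 \<le> (norm (?r n))\<^sup>2"
      unfolding norm_residue_diff[OF le_SucI[OF order_refl]] by simp
  qed
  then obtain l where l: "(\<lambda>n. (norm (?r n))\<^sup>2) \<longlonglongrightarrow> l"
    using decseq_convergent[of _ 0] by (metis zero_le_power2)
  have "Cauchy ?r"
  proof (rule metric_CauchyI)
    fix e :: real assume e: "0 < e"
    then have "0 < e\<^sup>2" by simp
    from metric_CauchyD[OF LIMSEQ_imp_Cauchy[OF l] this]
    obtain N where N: "\<And>m n. m \<ge> N \<Longrightarrow> n \<ge> N \<Longrightarrow> \<bar>(norm (?r m))\<^sup>2 - (norm (?r n))\<^sup>2\<bar> < e\<^sup>2"
      unfolding dist_real_def by blast
    have *: "dist (?r m) (?r n) < e" if "N \<le> m" "m \<le> n" for m n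
    proof -
      have "(norm (?r m - ?r n))\<^sup>2 < e\<^sup>2"
        using N[of m n] that unfolding norm_residue_diff[OF that(2)] by simp
      then show ?thesis using e by (simp add: dist_norm power2_less_imp_less)
    qed
    have "dist (?r m) (?r n) < e" if "N \<le> m" "N \<le> n" for m n
      using *[of m n] *[of n m] that by (cases "m \<le> n") (simp_all add: dist_commute)
    then show "\<exists>N. \<forall>m\<ge>N. \<forall>n\<ge>N. dist (?r m) (?r n) < e" by blast
  qed
  then obtain y where y: "?r \<longlonglongrightarrow> y" using Cauchy_convergent convergent_def by blast
  show ?thesis
  proof (rule that)
    show "y \<in> Hpi" by (rule closed_sequentially[OF closed_Hpi residue_Hpi y])
    show "\<forall>k. Q (C k) y = 0"
    proof
      fix k
      have "(\<lambda>n. Q (C k) (?r n)) \<longlonglongrightarrow> Q (C k) y"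
        by (rule bounded_linear.tendsto[OF bounded_linear_Q[OF C] y])
      moreover have "(\<lambda>n. Q (C k) (?r n)) \<longlonglongrightarrow> 0"
        \<comment> \<open>The sequence is exactly zero from \<open>n > k\<close> on.\<close>
        by (rule tendsto_eventually, rule eventually_mono[OF eventually_gt_at_top[of k]])
          (rule Q_residue)
      ultimately show "Q (C k) y = 0" by (rule LIMSEQ_unique)
    qed
    have "cinner x (?r n) = of_real ((norm (?r n))\<^sup>2)" for n
      using cinner_residue_diff[of 0 n n] by (simp add: cinner_diff_left cinner_self_norm)
    moreover have "(\<lambda>n. cinner x (?r n)) \<longlonglongrightarrow> cinner x y"
      by (rule bounded_linear.tendsto[OF bounded_linear_cinner_right y])
    moreover have "(\<lambda>n. complex_of_real ((norm (?r n))\<^sup>2)) \<longlonglongrightarrow> of_real ((norm y)\<^sup>2)"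
      by (intro tendsto_intros y)
    ultimately show "cinner x y = of_real ((norm y)\<^sup>2)" by (simp add: LIMSEQ_unique)
    have "(\<lambda>n. (norm (x - ?r n))\<^sup>2) \<longlonglongrightarrow> (norm (x - y))\<^sup>2" by (intro tendsto_intros y)
    moreover have "(norm (x - ?r n))\<^sup>2 \<le> nu x (\<Union>k. cyl (C k))" for n
    proof -
      have *: "(\<Union>k<n. cyl (C k)) \<in> Sigma_alg S \<Gamma>" "(\<Union>k. cyl (C k)) \<in> Sigma_alg S \<Gamma>"
        using cyl_sets[OF C] by (intro finite_UN countable_UN; auto)+
      have "(norm (x - ?r n))\<^sup>2 = nu x (Omega S \<Gamma>) - nu x (Omega S \<Gamma> - (\<Union>k<n. cyl (C k)))"
        using norm_residue_diff[of 0 n] by (simp add: norm_residue nu_Omega x)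
      also have "\<dots> = nu x (Omega S \<Gamma> \<inter> (\<Union>k<n. cyl (C k)))"
        using nu_Diff[OF x top *(1)] by simp
      also have "\<dots> \<le> nu x (\<Union>k. cyl (C k))" by (intro nu_mono x *) auto
      finally show ?thesis .
    qed
    ultimately show "(norm (x - y))\<^sup>2 \<le> nu x (\<Union>k. cyl (C k))"
      by (intro LIMSEQ_le_const2) auto
  qed
qed

end

section \<open>Approximation by vectors of \<open>F_set\<close> and bounds against them\<close>

lemma nu_outer_regular:
  assumes x: "x \<in> Hpi" and A: "A \<in> Sigma_alg S \<Gamma>" and e: "0 < (e::real)"
  obtains \<L> where "countable \<L>" "\<L> \<subseteq> {L. valid L}" "A \<subseteq> (\<Union>L\<in>\<L>. cyl L)"
    "nu x (\<Union>L\<in>\<L>. cyl L) \<le> nu x A + e"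
proof (cases "x = 0")
  case True
  \<comment> \<open>\<open>P 0\<close> is unspecified, but \<open>nu 0\<close> vanishes, so the
    whole space, as the cylinder of \<open>[]\<close>, serves as a cover.\<close>
  have "A \<subseteq> (\<Union>L\<in>{[]}. cyl L)" using sets_into_space[OF A] by simp
  then show ?thesis by (rule that[of "{[]}", rotated 2]) (use e True in auto)
next
  case False
  have "finite_measure (P x)" using P_props(1)[OF x False] prob_space_def by blast
  \<comment> \<open>Dividing \<open>e\<close> by the squared norm undoes the normalisation of
    \<open>P\<close>.\<close>
  then obtain U where U: "cyl_open U" "A \<subseteq> U" "measure (P x) U < measure (P x) A + e / (norm x)\<^sup>2"
    using cyl_outer_regular[OF _ P_props(3)[OF x False] A, of "e / (norm x)\<^sup>2"] e False by auto
  then have "nu x U \<le> (norm x)\<^sup>2 * (measure (P x) A + e / (norm x)\<^sup>2)"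
    unfolding nu_def by (intro mult_left_mono) auto
  also have "\<dots> = nu x A + e" using False by (simp add: nu_def distrib_left)
  finally show ?thesis using that U unfolding cyl_open_def by metis
qed

text \<open>Apply \<open>residue_limit\<close> to a cover of \<open>A\<close> by cylinders of nearly
  minimal mass: every point of \<open>A\<close> lies in one of them, and its operator annihilates
  \<open>y\<close>.\<close>

lemma F_set_approximation:
  assumes x: "x \<in> Hpi" and A: "A \<in> Sigma_alg S \<Gamma>" and e: "0 < (e::real)"
  obtains y where "y \<in> F_set S p A" "y \<in> Hpi" "(norm (x - y))\<^sup>2 \<le> nu x A + e"
    "cinner x y = of_real ((norm y)\<^sup>2)"
proof -
  obtain \<L> where \<L>: "countable \<L>" "\<L> \<subseteq> {L. valid L}" "A \<subseteq> (\<Union>L\<in>\<L>. cyl L)"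
    "nu x (\<Union>L\<in>\<L>. cyl L) \<le> nu x A + e"
    using nu_outer_regular[OF assms] .
  show ?thesis
  \<comment> \<open>\<open>from_nat_into\<close> enumerates nonempty sets only. An empty cover means
    \<open>A = {}\<close>; then \<open>F_set\<close> is the whole space and \<open>y = x\<close>
    works.\<close>
  proof (cases "\<L> = {}")
    case True
    then have "A = {}" using \<L>(3) by simp
    then show ?thesis using e x by (intro that[of x]) (auto simp: F_set_def cinner_self_norm)
  next
    case False
    \<comment> \<open>The enumeration may repeat a cylinder; a repetition removes nothing
      further.\<close>
    define C where "C = from_nat_into \<L>"
    have range: "range C = \<L>" using False \<L>(1) by (simp add: C_def)
    then have C: "valid (C n)" for n using \<L>(2) by blast
    have U: "(\<Union>L\<in>\<L>. cyl L) = (\<Union>k. cyl (C k))" using range by blast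
    obtain y where y: "y \<in> Hpi" "\<forall>k. Q (C k) y = 0" "cinner x y = of_real ((norm y)\<^sup>2)"
      "(norm (x - y))\<^sup>2 \<le> nu x (\<Union>k. cyl (C k))"
      using residue_limit[of C, OF C x] .
    have "y \<in> F_set S p A"
      unfolding F_set_iff[OF sets_into_space[OF A]]
      using \<L>(3) C y(2) annihilates_if_Q_eq_0 unfolding U by blast
    then show ?thesis using that y \<L>(4) unfolding U by fastforce
  qed
qed

text \<open>By compactness finitely many removals suffice. They leave \<open>cinner y x\<close>
  unchanged, and Cauchy-Schwarz is applied to \<open>y\<close> and the last residue.\<close>

lemma F_set_cinner_bound:
  assumes fin: "\<forall>t\<in>S. finite (\<Gamma> t)" and x: "x \<in> Hpi" and A: "A \<in> Sigma_alg S \<Gamma>"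
    and y: "y \<in> F_set S p A"
  shows "(cmod (cinner y x))\<^sup>2 \<le> (norm y)\<^sup>2 * nu x (Omega S \<Gamma> - A)"
proof -
  have *: "(cmod (cinner y x))\<^sup>2 \<le> (norm y)\<^sup>2 * (nu x (Omega S \<Gamma> - A) + e)" if e: "0 < e" for e
  proof -
    obtain \<L> where \<L>: "countable \<L>" "\<L> \<subseteq> {L. valid L}" "Omega S \<Gamma> - A \<subseteq> (\<Union>L\<in>\<L>. cyl L)"
      "nu x (\<Union>L\<in>\<L>. cyl L) \<le> nu x (Omega S \<Gamma> - A) + e"
      using nu_outer_regular[OF x compl_sets[OF A] e] .
    \<comment> \<open>This family may be uncountable; compactness leaves finitely many of its
      members.\<close>
    define \<M> where "\<M> = {L. valid L \<and> annihilates L y}"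
    have "A \<subseteq> (\<Union>L\<in>\<M>. cyl L)"
      using y unfolding F_set_iff[OF sets_into_space[OF A]] \<M>_def by blast
    then have "Omega S \<Gamma> \<subseteq> (\<Union>L\<in>\<L> \<union> \<M>. cyl L)" using \<L>(3) by blast
    moreover have "\<L> \<union> \<M> \<subseteq> {L. valid L}" using \<L>(2) by (auto simp: \<M>_def)
    ultimately obtain \<F> where \<F>: "finite \<F>" "\<F> \<subseteq> \<L> \<union> \<M>" "Omega S \<Gamma> \<subseteq> (\<Union>L\<in>\<F>. cyl L)"
      using finite_cylinder_cover[OF fin] by metis
    obtain ls where ls: "set ls = \<F> \<inter> \<M>" using \<F>(1) finite_list[of "\<F> \<inter> \<M>"] by auto
    \<comment> \<open>Padding with \<open>[]\<close> makes \<open>C\<close> total and valid; only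
      residues up to index \<open>length ls\<close> occur.\<close>
    define C where "C n = (if n < length ls then ls ! n else [])" for n
    have CM: "C n \<in> \<M>" if "n < length ls" for n using ls that nth_mem by (fastforce simp: C_def)
    then have C: "valid (C n)" for n by (cases "n < length ls") (auto simp: \<M>_def C_def)
    let ?r = "residue C x"
    have "cinner y (?r n) = cinner y x" if "n \<le> length ls" for n
      using that
    proof (induction n)
      case (Suc n)
      have "annihilates (C n) y" using CM[of n] Suc.prems by (simp add: \<M>_def)
      then have "cinner y (Q (C n) (?r n)) = 0"
        by (rule annihilates_Q[OF _ residue_Hpi[OF C x] C])
      with Suc show ?case by (simp add: cinner_diff_right)
    qed simp
    then have "(cmod (cinner y x))\<^sup>2 \<le> (norm y * norm (?r (length ls)))\<^sup>2"
      using cmod_cinner_le[of y "?r (length ls)"] by (intro power_mono) auto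
    also have "\<dots> = (norm y)\<^sup>2 * nu x (Omega S \<Gamma> - (\<Union>k<length ls. cyl (C k)))"
      by (simp add: power_mult_distrib norm_residue C x)
    also have "\<dots> \<le> (norm y)\<^sup>2 * nu x (\<Union>L\<in>\<L>. cyl L)"
    proof (intro mult_left_mono nu_mono x)
      show "(\<Union>L\<in>\<L>. cyl L) \<in> Sigma_alg S \<Gamma>"
        using \<L>(1,2) cyl_open_sets unfolding cyl_open_def by blast
      have "C ` {..<length ls} = set ls" by (auto simp: C_def set_conv_nth)
      then have "(\<Union>k<length ls. cyl (C k)) = (\<Union>L\<in>\<F> \<inter> \<M>. cyl L)"
        unfolding ls[symmetric] by (metis image_image)
      \<comment> \<open>Points missed by the removed cylinders are covered by the other members of
        \<F>, which come from \<L>.\<close>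
      moreover have "Omega S \<Gamma> - (\<Union>L\<in>\<F> \<inter> \<M>. cyl L) \<subseteq> (\<Union>L\<in>\<L>. cyl L)"
      proof
        fix \<omega> assume \<omega>: "\<omega> \<in> Omega S \<Gamma> - (\<Union>L\<in>\<F> \<inter> \<M>. cyl L)"
        then obtain L where "L \<in> \<F>" "\<omega> \<in> cyl L" using \<F>(3) by blast
        moreover from this have "L \<in> \<L>" using \<omega> \<F>(2) by blast
        ultimately show "\<omega> \<in> (\<Union>L\<in>\<L>. cyl L)" by blast
      qed
      ultimately show "Omega S \<Gamma> - (\<Union>k<length ls. cyl (C k)) \<subseteq> (\<Union>L\<in>\<L>. cyl L)" by simp
    qed simp
    also have "\<dots> \<le> (norm y)\<^sup>2 * (nu x (Omega S \<Gamma> - A) + e)"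
      using \<L>(4) by (intro mult_left_mono) auto
    finally show ?thesis .
  qed
  have "((\<lambda>e. (norm y)\<^sup>2 * (nu x (Omega S \<Gamma> - A) + e)) \<longlongrightarrow> (norm y)\<^sup>2 * (nu x (Omega S \<Gamma> - A) + 0)) (at_right 0)"
    by (intro tendsto_intros)
  moreover have "\<forall>\<^sub>F e in at_right 0. (cmod (cinner y x))\<^sup>2 \<le> (norm y)\<^sup>2 * (nu x (Omega S \<Gamma> - A) + e)"
    by (rule eventually_mono[OF eventually_at_right_less[of 0]]) (rule *)
  ultimately have "(cmod (cinner y x))\<^sup>2 \<le> (norm y)\<^sup>2 * (nu x (Omega S \<Gamma> - A) + 0)"
    by (rule tendsto_lowerbound) simp
  then show ?thesis by simp
qed

text \<open>Both sides are continuous in \<open>y\<close>.\<close>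

lemma F_set_cinner_bound_closure:
  assumes fin: "\<forall>t\<in>S. finite (\<Gamma> t)" and x: "x \<in> Hpi" and A: "A \<in> Sigma_alg S \<Gamma>"
    and y: "y \<in> closure (F_set S p A)"
  shows "(cmod (cinner y x))\<^sup>2 \<le> (norm y)\<^sup>2 * nu x (Omega S \<Gamma> - A)"
proof -
  have "closed {y. (cmod (cinner y x))\<^sup>2 \<le> (norm y)\<^sup>2 * nu x (Omega S \<Gamma> - A)}"
    by (intro closed_Collect_le continuous_intros continuous_on_cinner_left)
  then have "closure (F_set S p A) \<subseteq> {y. (cmod (cinner y x))\<^sup>2 \<le> (norm y)\<^sup>2 * nu x (Omega S \<Gamma> - A)}"
    using F_set_cinner_bound[OF fin x A] by (intro closure_minimal) auto
  with y show ?thesis by blast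
qed

section \<open>Event subspaces and the closure of \<open>F_set\<close>\<close>

lemma nu_nonneg: "0 \<le> nu x D"
  by (simp add: nu_def)

lemma nu_compl:
  assumes "x \<in> Hpi" "A \<in> Sigma_alg S \<Gamma>"
  shows "nu x (Omega S \<Gamma> - A) = (norm x)\<^sup>2 - nu x A"
  using nu_Diff[OF assms(1) top assms(2)] sets_into_space[OF assms(2)] nu_Omega[OF assms(1)]
  by (simp add: Int_absorb1)

lemma nu_eq_0_iff: "nu x A = 0 \<longleftrightarrow> x = 0 \<or> measure (P x) A = 0"
  by (simp add: nu_def)

text \<open>The mass of the complement under \<open>nu\<close> absorbs the separate clause for
  \<open>x = 0\<close>.\<close>

lemma H_event_iff:
  assumes "A \<in> Sigma_alg S \<Gamma>"
  shows "x \<in> H_event S \<Gamma> p P A \<longleftrightarrow> x \<in> Hpi \<and> nu x (Omega S \<Gamma> - A) = 0"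
  using assms by (auto simp: H_event_def nu_compl) (auto simp: nu_def)

text \<open>Such an \<open>x\<close> lies in \<open>Hpi\<close>, so
  \<open>F_set_approximation\<close> applies. Orthogonality forces the approximating
  \<open>y\<close> to be 0, and then \<open>A\<close> carries the whole mass of
  \<open>x\<close>.\<close>

lemma orth_F_set_subset_H_event:
  assumes A: "A \<in> Sigma_alg S \<Gamma>"
  shows "orth (F_set S p A) \<subseteq> H_event S \<Gamma> p P A"
proof
  fix x assume x: "x \<in> orth (F_set S p A)"
  then have xH: "x \<in> Hpi" using orth_F_set_subset_Hpi[OF sets_into_space[OF A]] by blast
  have "(norm x)\<^sup>2 \<le> nu x A + e" if e: "0 < e" for e
  proof -
    obtain y where y: "y \<in> F_set S p A" "(norm (x - y))\<^sup>2 \<le> nu x A + e"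
      "cinner x y = of_real ((norm y)\<^sup>2)"
      using F_set_approximation[OF xH A e] by metis
    have "cinner x y = 0" using x y(1) by (simp add: orth_def)
    then have "y = 0" using y(3) by simp
    then show ?thesis using y(2) by simp
  qed
  then have "(norm x)\<^sup>2 \<le> nu x A" by (rule field_le_epsilon)
  then have "nu x (Omega S \<Gamma> - A) = 0"
    using nu_compl[OF xH A] nu_nonneg[of x "Omega S \<Gamma> - A"] by simp
  then show "x \<in> H_event S \<Gamma> p P A" using xH H_event_iff[OF A] by blast
qed

text \<open>The approximating vectors can be kept inside \<open>Hpi\<close>, which the second
  equation of (e) requires.\<close>

lemma nu_0_imp_closure_F_set:
  assumes x: "x \<in> Hpi" and A: "A \<in> Sigma_alg S \<Gamma>" and nu: "nu x A = 0"
  shows "x \<in> closure (F_set S p A \<inter> Hpi)"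
  unfolding closure_approachable
proof (intro allI impI)
  fix e :: real assume e: "0 < e"
  then have "0 < (e / 2)\<^sup>2" by simp
  from F_set_approximation[OF x A this]
  obtain y where y: "y \<in> F_set S p A" "y \<in> Hpi" "(norm (x - y))\<^sup>2 \<le> nu x A + (e / 2)\<^sup>2"
    by metis
  from y(3) have "(norm (x - y))\<^sup>2 \<le> (e / 2)\<^sup>2" unfolding nu by simp
  then have "norm (x - y) \<le> e / 2" by (rule power2_le_imp_le) (use e in simp)
  then have "dist y x < e" using e by (simp add: dist_norm norm_minus_commute)
  with y show "\<exists>y\<in>F_set S p A \<inter> Hpi. dist y x < e" by blast
qed

text \<open>Taking \<open>y = x\<close> in the bound over the closure shows that the complement of
  \<open>A\<close> carries the whole mass of \<open>x\<close>.\<close>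

lemma closure_F_set_imp_nu_0:
  assumes fin: "\<forall>t\<in>S. finite (\<Gamma> t)" and x: "x \<in> Hpi" and A: "A \<in> Sigma_alg S \<Gamma>"
    and cl: "x \<in> closure (F_set S p A)"
  shows "nu x A = 0"
proof (cases "x = 0")
  case False
  have "(norm x)\<^sup>2 * (norm x)\<^sup>2 \<le> (norm x)\<^sup>2 * nu x (Omega S \<Gamma> - A)"
    using F_set_cinner_bound_closure[OF fin x A cl]
    unfolding cinner_self_norm norm_of_real by (simp add: power2_eq_square)
  then have "(norm x)\<^sup>2 \<le> nu x (Omega S \<Gamma> - A)"
    by (rule mult_left_le_imp_le) (use False in simp)
  then show ?thesis using nu_compl[OF x A] nu_nonneg[of x A] by simp
qed simp

text \<open>Complements reverse the inclusion \<open>orth_F_set_subset_H_event\<close>, and the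
  double complement of a subspace is its closure.\<close>

lemma orth_H_event_subset_closure:
  assumes A: "A \<in> Sigma_alg S \<Gamma>"
  shows "orth (H_event S \<Gamma> p P A) \<subseteq> closure (F_set S p A)"
  using orth_antimono[OF orth_F_set_subset_H_event[OF A]]
    orth_orth[OF csubspace_F_set[OF sets_into_space[OF A]]] by simp

text \<open>The difference is orthogonal to \<open>Hpi\<close>, hence to \<open>H_event\<close>, so
  (a) applies.\<close>

lemma diff_proj_onto_closure:
  assumes A: "A \<in> Sigma_alg S \<Gamma>"
  shows "x - proj_onto Hpi x \<in> closure (F_set S p A)"
proof -
  have "x - proj_onto Hpi x \<in> orth Hpi"
    using proj_onto_props(2)[OF csubspace_Hpi closed_Hpi] by (simp add: orth_def)
  moreover have "H_event S \<Gamma> p P A \<subseteq> Hpi" by (auto simp: H_event_def)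
  ultimately show ?thesis using orth_antimono orth_H_event_subset_closure[OF A] by blast
qed

text \<open>Reduces (b) and (d) to vectors of \<open>Hpi\<close>, where \<open>P\<close> is
  specified.\<close>

lemma closure_F_set_iff_proj_onto:
  assumes A: "A \<in> Sigma_alg S \<Gamma>"
  shows "x \<in> closure (F_set S p A) \<longleftrightarrow> proj_onto Hpi x \<in> closure (F_set S p A)"
proof -
  have sub: "csubspace (closure (F_set S p A))"
    by (rule csubspace_closure[OF csubspace_F_set[OF sets_into_space[OF A]]])
  note d = diff_proj_onto_closure[OF A, of x]
  have "x - (x - proj_onto Hpi x) \<in> closure (F_set S p A)" if "x \<in> closure (F_set S p A)"
    by (rule csubspace_diff[OF sub that d])
  moreover have "(x - proj_onto Hpi x) + proj_onto Hpi x \<in> closure (F_set S p A)"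
    if "proj_onto Hpi x \<in> closure (F_set S p A)"
    using sub d that unfolding csubspace_def by blast
  ultimately show ?thesis by auto
qed

lemma H_event_eq_orth_F_set:
  assumes fin: "\<forall>t\<in>S. finite (\<Gamma> t)" and A: "A \<in> Sigma_alg S \<Gamma>"
  shows "H_event S \<Gamma> p P A = orth (F_set S p A)"
proof
  show "H_event S \<Gamma> p P A \<subseteq> orth (F_set S p A)"
  proof
    fix x assume "x \<in> H_event S \<Gamma> p P A"
    then have x: "x \<in> Hpi" "nu x (Omega S \<Gamma> - A) = 0" using H_event_iff[OF A] by auto
    have "cinner y x = 0" if "y \<in> F_set S p A" for y
      using F_set_cinner_bound[OF fin x(1) A that] x(2) by simp
    then show "x \<in> orth (F_set S p A)" unfolding orth_def using cinner_eq_0_commute by blast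
  qed
qed (rule orth_F_set_subset_H_event[OF A])

end

theorem theorem3:
  fixes S :: "'s set" and \<Gamma> :: "'s \<Rightarrow> 'b set"
    and p :: "'s \<Rightarrow> 'b \<Rightarrow> 'h::chilbert_space \<Rightarrow> 'h"
    and P :: "'h \<Rightarrow> ('s \<Rightarrow> 'b) measure"
    and A :: "('s \<Rightarrow> 'b) set"
  assumes pvm: "PVM_family S \<Gamma> p"
    and P: "is_P_family S \<Gamma> p P"
    and A: "A \<in> Sigma_alg S \<Gamma>"
  defines "Hpi \<equiv> H_pi (pi_set S \<Gamma> p)"
  shows "orth (H_event S \<Gamma> p P A) \<subseteq> closure (F_set S p A)
       \<and> (\<forall>\<phi>. (proj_onto Hpi \<phi> = 0 \<or> measure (P (proj_onto Hpi \<phi>)) A = 0)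
              \<longrightarrow> \<phi> \<in> closure (F_set S p A))
       \<and> ((\<forall>t\<in>S. finite (\<Gamma> t)) \<longrightarrow>
            (H_event S \<Gamma> p P A = orth (F_set S p A)
             \<and> orth (H_event S \<Gamma> p P A) = closure (F_set S p A))
          \<and> (\<forall>\<phi>. \<phi> \<in> closure (F_set S p A)
                 \<longleftrightarrow> (proj_onto Hpi \<phi> = 0 \<or> measure (P (proj_onto Hpi \<phi>)) A = 0))
          \<and> (H_event S \<Gamma> p P A = closure (F_set S p (Omega S \<Gamma> - A)) \<inter> Hpi
             \<and> H_event S \<Gamma> p P A = closure (F_set S p (Omega S \<Gamma> - A) \<inter> Hpi)))"
proof -
  interpret pvm_prob S \<Gamma> p P by unfold_locales (rule pvm, rule P)
  note Ac = compl_sets[OF A]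
  have proj: "proj_onto Hpi \<phi> \<in> Hpi" for \<phi>
    unfolding Hpi_def by (rule proj_onto_props(1)[OF csubspace_Hpi closed_Hpi])
  have a: "orth (H_event S \<Gamma> p P A) \<subseteq> closure (F_set S p A)"
    by (rule orth_H_event_subset_closure[OF A])
  have b: "\<phi> \<in> closure (F_set S p A)"
    if "proj_onto Hpi \<phi> = 0 \<or> measure (P (proj_onto Hpi \<phi>)) A = 0" for \<phi>
  proof -
    have "proj_onto Hpi \<phi> \<in> closure (F_set S p A \<inter> Hpi)"
      using nu_0_imp_closure_F_set[OF _ A] proj that unfolding Hpi_def nu_eq_0_iff by blast
    then have "proj_onto Hpi \<phi> \<in> closure (F_set S p A)" using closure_mono[OF Int_lower1] by blast
    then show ?thesis using closure_F_set_iff_proj_onto[OF A] unfolding Hpi_def by blast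
  qed
  have c: "H_event S \<Gamma> p P A = orth (F_set S p A)" "orth (H_event S \<Gamma> p P A) = closure (F_set S p A)"
    if "\<forall>t\<in>S. finite (\<Gamma> t)"
    using H_event_eq_orth_F_set[OF that A] orth_orth[OF csubspace_F_set[OF sets_into_space[OF A]]]
    by simp_all
  have d: "proj_onto Hpi \<phi> = 0 \<or> measure (P (proj_onto Hpi \<phi>)) A = 0"
    if "\<forall>t\<in>S. finite (\<Gamma> t)" "\<phi> \<in> closure (F_set S p A)" for \<phi>
    using that(2) closure_F_set_imp_nu_0[OF that(1) _ A] proj closure_F_set_iff_proj_onto[OF A]
    unfolding Hpi_def nu_eq_0_iff by blast
  \<comment> \<open>By \<open>H_event_iff\<close>, \<open>H_event\<close> consists of the vectors of
    \<open>Hpi\<close> that give the complement of \<open>A\<close> no mass. Both equations follow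
    from (b) and (d) for the complement, through a cycle of three inclusions.\<close>
  have e: "H_event S \<Gamma> p P A = closure (F_set S p (Omega S \<Gamma> - A)) \<inter> Hpi"
    "H_event S \<Gamma> p P A = closure (F_set S p (Omega S \<Gamma> - A) \<inter> Hpi)"
    if fin: "\<forall>t\<in>S. finite (\<Gamma> t)"
  proof -
    have "H_event S \<Gamma> p P A \<subseteq> closure (F_set S p (Omega S \<Gamma> - A) \<inter> Hpi)"
      using nu_0_imp_closure_F_set[OF _ Ac] H_event_iff[OF A] unfolding Hpi_def by blast
    moreover have "closure (F_set S p (Omega S \<Gamma> - A) \<inter> Hpi) \<subseteq> closure (F_set S p (Omega S \<Gamma> - A)) \<inter> Hpi"
      using closed_Hpi closure_subset unfolding Hpi_def by (intro Int_greatest closure_mono closure_minimal) auto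
    moreover have "closure (F_set S p (Omega S \<Gamma> - A)) \<inter> Hpi \<subseteq> H_event S \<Gamma> p P A"
      using closure_F_set_imp_nu_0[OF fin _ Ac] H_event_iff[OF A] unfolding Hpi_def by blast
    ultimately show "H_event S \<Gamma> p P A = closure (F_set S p (Omega S \<Gamma> - A)) \<inter> Hpi"
      "H_event S \<Gamma> p P A = closure (F_set S p (Omega S \<Gamma> - A) \<inter> Hpi)" by auto
  qed
  show ?thesis using a b c d e by blast
qed

end
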